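(* Let $(W,S)$ be a finite Weyl group with its usual reflection representation on the rational vector space $V$, let $\mathcal{C}\subseteq V$ be the Weyl chamber corresponding to $S$, and let $\lambda\in\mathcal{C}$. Let $\mathcal{P}_\lambda=\mathrm{Conv}(W\cdot\lambda)$ be the convex hull of the orbit $W\cdot\lambda$ in $V$. The following are equivalent. (1) $\mathcal{P}_\lambda$ is a simple polytope. (2) There are exactly $|S|$ edges of $\mathcal{P}_\lambda$ meeting at $\lambda$. (3) $J=\{s\in S\mid s(\lambda)=\lambda\}$ has the following properties: (a) If $s\in S\setminus J$ and $J\not\subseteq C_W(s)$, then there is a unique $t\in J$ such that $st\neq ts$. If $C\in\pi_0(J)$ is the unique connected component of $J$ with $t\in C$, then $C\setminus\{t\}\subseteq C$ is a setup of type $A_{l-1}\subseteq A_l$. (b) For each $C\in\pi_0(J)$ there is a unique $s\in S\setminus J$ such that $st\neq ts$ for some $t\in C$.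
   Context: The Weyl chamber $\mathcal{C}$ is the (closed) chamber that is a fundamental domain for the action of $W$ on $V$, and $S$ is the corresponding set of simple reflections. $S$ is regarded as the vertex set of a graph with an edge between $s$ and $t$ whenever $st\neq ts$; connected components of a subset of $S$ are those of the induced subgraph, and $\pi_0(J)$ denotes the set of connected components of $J\subseteq S$. $C_W(s)$ is the centralizer of $s$ in $W$. A polytope of dimension $m$ is simple if each vertex is the endpoint of exactly $m$ edges. "$C\setminus\{t\}\subseteq C$ is a setup of type $A_{l-1}\subseteq A_l$" means that the parabolic subgroup generated by $C$ is of type $A_l$ with $l=|C|$ and $t$ is an end node of its Dynkin diagram, so that $C\setminus\{t\}$ is of type $A_{l-1}$ (for $l=1$, $C=\{t\}$ and $C\setminus\{t\}=\emptyset$).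
   Formalization: The formal theorem adds the assumption that no connected component of S is contained in J (for W irreducible: λ ≠ 0); without it the claim fails, e.g. for λ = 0 and S nonempty the polytope is a point, hence simple, but has 0 ≠ |S| edges at λ. *)

theory Defs
  imports Complex_Main "HOL-Algebra.Bij" "HOL-Algebra.Multiplicative_Group"
begin

section \<open>Polytopes in rational vector spaces\<close>

text \<open>
  The library's convexity theory is tied to real vector spaces, so its definitions
  (convex, polytope, face, edge, extreme point) are repeated here with rational scalars;
  \<open>convex hull X\<close> is the generic hull operator for this notion of convexity.
\<close>

locale rational_vector_space = vector_space scale
  for scale :: "rat \<Rightarrow> 'v::ab_group_add \<Rightarrow> 'v" (infixr "*\<^sub>Q" 75)
begin

definition convex :: "'v set \<Rightarrow> bool" where
  "convex A \<longleftrightarrow>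
     (\<forall>x\<in>A. \<forall>y\<in>A. \<forall>u\<ge>0. \<forall>v\<ge>0. u + v = 1 \<longrightarrow> u *\<^sub>Q x + v *\<^sub>Q y \<in> A)"

definition polytope :: "'v set \<Rightarrow> bool" where
  "polytope P \<longleftrightarrow> (\<exists>X. finite X \<and> P = convex hull X)"

definition open_segment :: "'v \<Rightarrow> 'v \<Rightarrow> 'v set" where
  "open_segment a b = {(1 - u) *\<^sub>Q a + u *\<^sub>Q b | u. 0 \<le> u \<and> u \<le> 1} - {a, b}"

definition face_of :: "'v set \<Rightarrow> 'v set \<Rightarrow> bool" where
  "face_of F P \<longleftrightarrow> F \<subseteq> P \<and> convex F \<and>
     (\<forall>a\<in>P. \<forall>b\<in>P. \<forall>x\<in>F. x \<in> open_segment a b \<longrightarrow> a \<in> F \<and> b \<in> F)"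

definition aff_dim :: "'v set \<Rightarrow> int" where
  "aff_dim A = (if A = {} then -1 else int (dim {x - y | x y. x \<in> A \<and> y \<in> A}))"

definition edge_of :: "'v set \<Rightarrow> 'v set \<Rightarrow> bool" where
  "edge_of e P \<longleftrightarrow> face_of e P \<and> aff_dim e = 1"

definition vertex_of :: "'v \<Rightarrow> 'v set \<Rightarrow> bool" where
  "vertex_of x P \<longleftrightarrow> x \<in> P \<and> (\<forall>a\<in>P. \<forall>b\<in>P. x \<notin> open_segment a b)"

text \<open>A vertex of a polytope that lies on an edge is automatically an endpoint of that edge.\<close>

definition edges_at :: "'v set \<Rightarrow> 'v \<Rightarrow> 'v set set" where
  "edges_at P x = {e. edge_of e P \<and> x \<in> e}"

definition simple_polytope :: "'v set \<Rightarrow> bool" where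
  "simple_polytope P \<longleftrightarrow> polytope P \<and>
     (\<forall>x. vertex_of x P \<longrightarrow> int (card (edges_at P x)) = aff_dim P)"

end


section \<open>Finite Weyl groups in their reflection representation\<close>

text \<open>
  A reduced crystallographic root system \<open>\<Phi>\<close> spanning the rational vector space, with a
  base \<open>\<Delta>\<close>. The form \<open>form\<close> is a rational inner product in which the reflections are
  orthogonal. The whole type is the representation space.
\<close>

locale weyl_group = rational_vector_space scale
  for scale :: "rat \<Rightarrow> 'v::ab_group_add \<Rightarrow> 'v" (infixr "*\<^sub>Q" 75) +
  fixes form :: "'v \<Rightarrow> 'v \<Rightarrow> rat" and \<Phi> \<Delta> :: "'v set"
  assumes form_add: "form (x + y) z = form x z + form y z"
    and form_scale: "form (c *\<^sub>Q x) z = c * form x z"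
    and form_sym: "form x y = form y x"
    and form_pos: "x \<noteq> 0 \<Longrightarrow> form x x > 0"
    and finite_roots: "finite \<Phi>"
    and zero_not_root: "0 \<notin> \<Phi>"
    and span_roots: "span \<Phi> = UNIV"
    and reflection_root:
      "\<alpha> \<in> \<Phi> \<Longrightarrow> \<beta> \<in> \<Phi> \<Longrightarrow> \<beta> - (2 * form \<beta> \<alpha> / form \<alpha> \<alpha>) *\<^sub>Q \<alpha> \<in> \<Phi>"
    and crystallographic: "\<alpha> \<in> \<Phi> \<Longrightarrow> \<beta> \<in> \<Phi> \<Longrightarrow> 2 * form \<beta> \<alpha> / form \<alpha> \<alpha> \<in> \<int>"
    and reduced: "\<alpha> \<in> \<Phi> \<Longrightarrow> c *\<^sub>Q \<alpha> \<in> \<Phi> \<Longrightarrow> c = 1 \<or> c = -1"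
    and base_subset: "\<Delta> \<subseteq> \<Phi>"
    and base_independent: "independent \<Delta>"
    and base_span: "span \<Delta> = UNIV"
    and base_roots: "\<beta> \<in> \<Phi> \<Longrightarrow>
      \<exists>k :: 'v \<Rightarrow> nat. \<beta> = (\<Sum>\<alpha>\<in>\<Delta>. of_nat (k \<alpha>) *\<^sub>Q \<alpha>) \<or> \<beta> = - (\<Sum>\<alpha>\<in>\<Delta>. of_nat (k \<alpha>) *\<^sub>Q \<alpha>)"
begin

definition reflection :: "'v \<Rightarrow> 'v \<Rightarrow> 'v" where
  "reflection \<alpha> x = x - (2 * form x \<alpha> / form \<alpha> \<alpha>) *\<^sub>Q \<alpha>"

definition simple_reflections :: "('v \<Rightarrow> 'v) set" where
  "simple_reflections = reflection ` \<Delta>"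

definition W :: "('v \<Rightarrow> 'v) set" where
  "W = generate (BijGroup UNIV) simple_reflections"

definition chamber :: "'v set" where
  "chamber = {x. \<forall>\<alpha>\<in>\<Delta>. form x \<alpha> \<ge> 0}"

definition orbit_polytope :: "'v \<Rightarrow> 'v set" where
  "orbit_polytope x = convex hull {w x | w. w \<in> W}"

end


section \<open>The Coxeter graph\<close>

text \<open>Group elements are maps of the representation space, and the product of \<open>s\<close> and \<open>t\<close>
  is \<open>s \<circ> t\<close>.\<close>

definition centralizer :: "('v \<Rightarrow> 'v) set \<Rightarrow> ('v \<Rightarrow> 'v) \<Rightarrow> ('v \<Rightarrow> 'v) set" where
  "centralizer W s = {w \<in> W. w \<circ> s = s \<circ> w}"

definition coxeter_edges :: "('v \<Rightarrow> 'v) set \<Rightarrow> (('v \<Rightarrow> 'v) \<times> ('v \<Rightarrow> 'v)) set" where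
  "coxeter_edges J = {(s, t). s \<in> J \<and> t \<in> J \<and> s \<circ> t \<noteq> t \<circ> s}"

definition components :: "('v \<Rightarrow> 'v) set \<Rightarrow> ('v \<Rightarrow> 'v) set set" where
  "components J = J // (coxeter_edges J)\<^sup>*"

text \<open>\<open>xs\<close> lists the nodes of a Dynkin diagram of type A in their linear order. That diagram
  is simply laced, so the Coxeter numbers \<open>m(s, t)\<close>, i.e. the orders of the products
  \<open>s t\<close>, determine it.\<close>

definition type_A_numbering :: "('v \<Rightarrow> 'v) list \<Rightarrow> bool" where
  "type_A_numbering xs \<longleftrightarrow> distinct xs \<and>
     (\<forall>i j. i < j \<and> j < length xs \<longrightarrow>
        group.ord (BijGroup UNIV) (xs ! i \<circ> xs ! j) = (if j = Suc i then 3 else 2))"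

text \<open>\<open>C - {t} \<subseteq> C\<close> is a setup of type \<open>A\<^sub>l\<^sub>-\<^sub>1 \<subseteq> A\<^sub>l\<close>, where \<open>l = |C| \<ge> 1\<close>.\<close>

definition type_A_setup :: "('v \<Rightarrow> 'v) set \<Rightarrow> ('v \<Rightarrow> 'v) \<Rightarrow> bool" where
  "type_A_setup C t \<longleftrightarrow>
     (\<exists>xs. xs \<noteq> [] \<and> set xs = C \<and> type_A_numbering xs \<and> (t = hd xs \<or> t = last xs))"

end

theory Submission
  imports Defs "HOL-Computational_Algebra.Primes"
begin

text \<open>
  Call a simple root fixing or moving according to whether its reflection fixes \<open>lam\<close>, and let
  \<open>W\<^sub>J\<close> be the group generated by the fixing reflections. Let \<open>E\<close> be the set of all \<open>u a\<close> with
  \<open>u\<close> in \<open>W\<^sub>J\<close> and \<open>a\<close> a moving root. The differences \<open>lam - x\<close>, for \<open>x\<close> in the orbit polytope, lie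
  in the cone over \<open>E\<close> (\<open>orbit_below\<close>, by the exchange property of words in simple reflections), and
  every element of \<open>E\<close> is a direction to another point of the orbit. A moving root is an extreme ray
  of the cone of all positive combinations of simple roots, so \<open>W\<^sub>J\<close>, which fixes \<open>lam\<close>, makes every
  element of \<open>E\<close> an extreme ray. Hence the edges at \<open>lam\<close> correspond to the elements of \<open>E\<close>
  (\<open>card_edges_at\<close>).

  Since no component of the graph consists of fixing reflections only, \<open>E\<close> spans the space. So there
  are \<open>|S|\<close> edges at \<open>lam\<close> if and only if \<open>E\<close> is linearly independent. The polytope has dimension
  \<open>|S|\<close> and \<open>W\<close> is transitive on its vertices, so this is also equivalent to simplicity.

  If \<open>E\<close> is independent, then each fixing reflection acts on \<open>E\<close> as a transposition, because the
  differences of two moved pairs are proportional (\<open>moves_one_pair\<close>). Two of these transpositions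
  either commute or share a point and satisfy the braid relation (\<open>moved_by_two\<close>). Thus the
  reflections of a component of \<open>J\<close> are the edges of a connected graph on \<open>E\<close>. Three edges at one
  point would give a triangle of simple roots, which positive definiteness excludes
  (\<open>no_triangle\<close>), and a cycle would give a linear relation between simple roots. So the graph is a
  path, and a moving root attached to the component is an end of it (\<open>component_type_A\<close>).
  Two moving roots attached to the same component would have orbits that share a moved pair.

  Conversely, if the component attached to \<open>a\<close> is of type \<open>A\<close> with \<open>l\<close> nodes and \<open>a\<close> is attached to an
  end, then the orbit of \<open>a\<close> consists of the at most \<open>l + 1\<close> points along the chain
  (\<open>chain_orbit\<close>). Each component being attached to one moving root, \<open>E\<close> then has at most
  \<open>|S|\<close> elements. As it spans, this is equality.
\<close>

section \<open>Convex hulls and cones\<close>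

context rational_vector_space
begin

lemma convex_Inter: "\<forall>A\<in>T. convex A \<Longrightarrow> convex (\<Inter>T)"
  unfolding convex_def by blast

lemma convex_hull: "convex (convex hull X)"
  by (rule hull_in) (rule convex_Inter)

lemma convex_vimage:
  assumes "convex A" "\<And>x y. f (x + y) = f x + f y" "\<And>c x. f (c *\<^sub>Q x) = c *\<^sub>Q f x"
  shows "convex (f -` A)"
  using assms unfolding convex_def by auto

lemma hull_image_subset:
  assumes "\<And>x y. f (x + y) = f x + f y" "\<And>c x. f (c *\<^sub>Q x) = c *\<^sub>Q f x" "f ` X \<subseteq> X"
  shows "f ` (convex hull X) \<subseteq> convex hull X"
proof -
  have "X \<subseteq> f -` (convex hull X)" using assms(3) hull_subset[of X convex] by blast
  then have "convex hull X \<subseteq> f -` (convex hull X)"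
    by (rule hull_minimal) (use assms(1,2) convex_vimage convex_hull in blast)
  then show ?thesis by auto
qed

text \<open>Removing a vertex leaves a convex set, so the hull of a set without that point is smaller.\<close>

lemma vertex_of_hull:
  assumes "vertex_of x (convex hull X)"
  shows "x \<in> X"
proof (rule ccontr)
  assume "x \<notin> X"
  define P where "P = convex hull X"
  have convex_P: "convex P" unfolding P_def by (rule convex_hull)
  have x: "vertex_of x P" using assms unfolding P_def .
  have "convex (P - {x})"
    unfolding convex_def
  proof (intro ballI allI impI)
    fix a b u v assume ab: "a \<in> P - {x}" "b \<in> P - {x}" and uv: "0 \<le> u" "0 \<le> v" "u + v = (1::rat)"
    then have "u *\<^sub>Q a + v *\<^sub>Q b \<in> P" using convex_P unfolding convex_def by blast
    moreover have "u *\<^sub>Q a + v *\<^sub>Q b \<noteq> x"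
    proof
      assume eq: "u *\<^sub>Q a + v *\<^sub>Q b = x"
      have "u = 1 - v" "v \<le> 1" using uv by auto
      then have "x \<in> open_segment a b"
        unfolding open_segment_def using ab eq uv by (intro DiffI CollectI exI[of _ v]) auto
      then show False using x ab unfolding vertex_of_def by blast
    qed
    ultimately show "u *\<^sub>Q a + v *\<^sub>Q b \<in> P - {x}" by blast
  qed
  then have "P \<subseteq> P - {x}" using \<open>x \<notin> X\<close> hull_subset[of X convex]
    unfolding P_def by (intro hull_minimal) auto
  then show False using x unfolding vertex_of_def by blast
qed

inductive_set cone :: "'v set \<Rightarrow> 'v set" for E :: "'v set" where
  zero: "0 \<in> cone E"
| add_ray: "x \<in> cone E \<Longrightarrow> e \<in> E \<Longrightarrow> 0 \<le> c \<Longrightarrow> x + c *\<^sub>Q e \<in> cone E"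

lemma cone_ray: "e \<in> E \<Longrightarrow> 0 \<le> c \<Longrightarrow> c *\<^sub>Q e \<in> cone E"
  using cone.add_ray[OF cone.zero] by simp

lemma cone_add:
  assumes "x \<in> cone E" "y \<in> cone E"
  shows "x + y \<in> cone E"
  using assms(2)
proof induction
  case (add_ray y e c)
  then show ?case
    using cone.add_ray[of "x + y" E e c] by (simp add: add.assoc)
qed (use assms in simp)

lemma cone_scale:
  assumes "x \<in> cone E" "0 \<le> k"
  shows "k *\<^sub>Q x \<in> cone E"
  using assms(1)
proof induction
  case (add_ray y e c)
  then show ?case
    using cone.add_ray[of "k *\<^sub>Q y" E e "k * c"] assms(2) by (simp add: scale_right_distrib)
qed (simp add: cone.zero)

lemma cone_split_ray:
  assumes "x \<in> cone E" "x \<noteq> 0"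
  obtains e c y where "e \<in> E" "0 < c" "y \<in> cone E" "x = c *\<^sub>Q e + y"
proof -
  have "x = 0 \<or> (\<exists>e c y. e \<in> E \<and> 0 < c \<and> y \<in> cone E \<and> x = c *\<^sub>Q e + y)"
    using assms(1)
  proof induction
    case (add_ray y e c)
    show ?case
    proof (cases "c = 0")
      case True
      with add_ray show ?thesis by simp
    next
      case False
      with add_ray show ?thesis by (metis add.commute order_le_less)
    qed
  qed simp
  with assms(2) that show thesis by blast
qed

lemma convex_shorten:
  assumes "convex P" "p \<in> P" "p - c *\<^sub>Q v \<in> P" "0 \<le> d" "d \<le> c"
  shows "p - d *\<^sub>Q v \<in> P"
proof (cases "c = 0")
  case True
  with assms show ?thesis by simp
next
  case False
  with assms have "0 < c" by simp
  have "(1 - d / c) *\<^sub>Q p + (d / c) *\<^sub>Q (p - c *\<^sub>Q v) \<in> P"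
    using assms \<open>0 < c\<close> unfolding convex_def by simp
  moreover have "(1 - d / c) *\<^sub>Q p + (d / c) *\<^sub>Q (p - c *\<^sub>Q v) = p - d *\<^sub>Q v"
    using \<open>0 < c\<close> by (simp add: scale_right_diff_distrib scale_left_diff_distrib)
  ultimately show ?thesis by simp
qed

text \<open>A short step along \<open>v + c *\<^sub>Q e\<close> is the midpoint of steps of twice that size along \<open>v\<close> and
  along \<open>c *\<^sub>Q e\<close>.\<close>

lemma convex_cone_steps:
  assumes P: "convex P" "p \<in> P"
    and ray: "\<And>e. e \<in> E \<Longrightarrow> \<exists>c>0. p - c *\<^sub>Q e \<in> P"
    and v: "v \<in> cone E"
  shows "\<exists>c>0. p - c *\<^sub>Q v \<in> P"
  using v
proof induction
  case zero
  show ?case using P by (intro exI[of _ 1]) simp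
next
  case (add_ray v e c)
  then obtain a where a: "0 < a" "p - a *\<^sub>Q v \<in> P" by blast
  obtain b where b: "0 < b" "p - b *\<^sub>Q e \<in> P" using ray add_ray by blast
  define d where "d = min (a / 2) (b / (2 * (c + 1)))"
  have d: "0 < d" using a b add_ray(3) by (simp add: d_def)
  have da: "2 * d \<le> a" by (simp add: d_def)
  have "d \<le> b / (2 * (c + 1))" by (simp add: d_def)
  then have "2 * d * (c + 1) \<le> b" using add_ray(3) by (simp add: field_simps)
  moreover have "2 * d * c \<le> 2 * d * (c + 1)" using d by simp
  ultimately have db: "2 * d * c \<le> b" by linarith
  have "p - (2 * d) *\<^sub>Q v \<in> P" "p - (2 * d * c) *\<^sub>Q e \<in> P"
    using convex_shorten[OF P a(2), of "2 * d"] convex_shorten[OF P b(2), of "2 * d * c"]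
      d da db add_ray(3) by simp_all
  then have "(1/2) *\<^sub>Q (p - (2 * d) *\<^sub>Q v) + (1/2) *\<^sub>Q (p - (2 * d * c) *\<^sub>Q e) \<in> P"
    using P(1) unfolding convex_def by simp
  moreover have "(1/2) *\<^sub>Q (p - (2 * d) *\<^sub>Q v) + (1/2) *\<^sub>Q (p - (2 * d * c) *\<^sub>Q e)
      = (1/2 + 1/2) *\<^sub>Q p - d *\<^sub>Q (v + c *\<^sub>Q e)"
    unfolding scale_left_distrib by (simp add: scale_right_diff_distrib scale_right_distrib)
  ultimately show ?case using d by auto
qed

end

section \<open>Edges at a vertex and rays of the cone of directions\<close>

text \<open>The directions from \<open>p\<close> into \<open>P\<close> are negated, because at a dominant vertex of an orbit
  polytope it is their negatives that are positive combinations of roots. The hypotheses say that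
  these negatives span the cone over \<open>E\<close> and that \<open>E\<close> has exactly one element on each of the
  extreme rays of that cone.\<close>

locale vertex_cone = rational_vector_space scale
  for scale :: "rat \<Rightarrow> 'v::ab_group_add \<Rightarrow> 'v" (infixr "*\<^sub>Q" 75) +
  fixes P E :: "'v set" and p :: 'v
  assumes convex_P: "convex P"
    and p_in_P: "p \<in> P"
    and direction_in_cone: "x \<in> P \<Longrightarrow> p - x \<in> cone E"
    and ray_feasible: "e \<in> E \<Longrightarrow> \<exists>c>0. p - c *\<^sub>Q e \<in> P"
    and ray_extreme: "e \<in> E \<Longrightarrow> v \<in> cone E \<Longrightarrow> w \<in> cone E \<Longrightarrow> v + w = c *\<^sub>Q e \<Longrightarrow>
          \<exists>d\<ge>0. v = d *\<^sub>Q e"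
    and ray_nonzero: "0 \<notin> E"
    and rays_distinct: "e \<in> E \<Longrightarrow> f \<in> E \<Longrightarrow> e = d *\<^sub>Q f \<Longrightarrow> e = f"
begin

text \<open>If \<open>c *\<^sub>Q e\<close> is a summand of \<open>v\<close> and \<open>- v\<close> lies in the cone, then so does \<open>- (c *\<^sub>Q e)\<close>, and
  extremality of \<open>e\<close>, applied to \<open>0 = 0 *\<^sub>Q e\<close>, makes \<open>- c\<close> nonnegative.\<close>

lemma cone_pointed:
  assumes "v \<in> cone E" "- v \<in> cone E"
  shows "v = 0"
proof (rule ccontr)
  assume "v \<noteq> 0"
  then obtain e c y where *: "e \<in> E" "0 < c" "y \<in> cone E" "v = c *\<^sub>Q e + y"
    using cone_split_ray[OF assms(1)] by blast
  have "y + - v \<in> cone E" using cone_add * assms by blast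
  moreover have "y + - v = (- c) *\<^sub>Q e" using * by simp
  ultimately have "\<exists>d\<ge>0. (- c) *\<^sub>Q e = d *\<^sub>Q e"
    using ray_extreme[OF *(1), of "y + - v" "c *\<^sub>Q e" 0] cone_ray[OF *(1), of c] *(2) by auto
  then show False using * ray_nonzero by (metis less_le_not_le neg_0_le_iff_le scale_right_imp_eq)
qed

lemma vertex: "vertex_of p P"
  unfolding vertex_of_def
proof (intro conjI ballI notI)
  fix a b assume ab: "a \<in> P" "b \<in> P" "p \<in> open_segment a b"
  then obtain u where u: "p = (1 - u) *\<^sub>Q a + u *\<^sub>Q b" "0 \<le> u" "u \<le> 1" "p \<noteq> a" "p \<noteq> b"
    unfolding open_segment_def by blast
  have "u \<noteq> 0" using u by auto
  define v where "v = u *\<^sub>Q (p - b)"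
  have "p = (1 - u) *\<^sub>Q p + u *\<^sub>Q p" by (simp flip: scale_left_distrib)
  then have "- v = (1 - u) *\<^sub>Q (p - a)"
    using u(1) unfolding v_def scale_right_diff_distrib by (simp add: algebra_simps)
  moreover have "(1 - u) *\<^sub>Q (p - a) \<in> cone E" "v \<in> cone E"
    unfolding v_def using u(2,3) ab(1,2) by (simp_all add: cone_scale direction_in_cone)
  ultimately have "v = 0" using cone_pointed by metis
  then show False using u \<open>u \<noteq> 0\<close> by (simp add: v_def)
qed (rule p_in_P)

definition ray_face :: "'v \<Rightarrow> 'v set" where
  "ray_face e = {x \<in> P. \<exists>c\<ge>0. p - x = c *\<^sub>Q e}"

lemma ray_face_face:
  assumes e: "e \<in> E"
  shows "face_of (ray_face e) P"
  unfolding face_of_def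
proof (intro conjI ballI impI)
  show "convex (ray_face e)"
    unfolding convex_def
  proof (intro ballI allI impI)
    fix x y u v assume xy: "x \<in> ray_face e" "y \<in> ray_face e" and uv: "0 \<le> u" "0 \<le> v" "u + v = (1::rat)"
    then obtain c d where cd: "0 \<le> c" "0 \<le> d" "p - x = c *\<^sub>Q e" "p - y = d *\<^sub>Q e"
      unfolding ray_face_def by blast
    have "p - (u *\<^sub>Q x + v *\<^sub>Q y) = (u + v) *\<^sub>Q p - (u *\<^sub>Q x + v *\<^sub>Q y)" using uv by simp
    also have "\<dots> = u *\<^sub>Q (p - x) + v *\<^sub>Q (p - y)"
      by (simp add: scale_right_diff_distrib scale_left_distrib)
    also have "\<dots> = (u * c + v * d) *\<^sub>Q e" by (simp add: cd scale_left_distrib)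
    finally show "u *\<^sub>Q x + v *\<^sub>Q y \<in> ray_face e"
      using xy uv cd convex_P unfolding ray_face_def convex_def
      by (intro CollectI conjI exI[of _ "u * c + v * d"]) auto
  qed
next
  fix a b x assume ab: "a \<in> P" "b \<in> P" and x: "x \<in> ray_face e" "x \<in> open_segment a b"
  then obtain u c where u: "x = (1 - u) *\<^sub>Q a + u *\<^sub>Q b" "0 \<le> u" "u \<le> 1" "x \<noteq> a" "x \<noteq> b"
    and c: "p - x = c *\<^sub>Q e"
    unfolding open_segment_def ray_face_def by blast
  have u01: "u \<noteq> 0" "1 - u \<noteq> 0" using u by auto
  have "p - x = ((1 - u) + u) *\<^sub>Q p - x" by simp
  also have "\<dots> = (1 - u) *\<^sub>Q (p - a) + u *\<^sub>Q (p - b)"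
    unfolding scale_left_distrib u(1) by (simp add: scale_right_diff_distrib)
  finally have sum: "(1 - u) *\<^sub>Q (p - a) + u *\<^sub>Q (p - b) = c *\<^sub>Q e" using c by simp
  have cones: "(1 - u) *\<^sub>Q (p - a) \<in> cone E" "u *\<^sub>Q (p - b) \<in> cone E"
    using u ab by (auto intro: cone_scale direction_in_cone)
  have 1: "\<exists>d\<ge>0. (1 - u) *\<^sub>Q (p - a) = d *\<^sub>Q e"
    using ray_extreme[OF e cones sum] .
  have 2: "\<exists>d\<ge>0. u *\<^sub>Q (p - b) = d *\<^sub>Q e"
    using ray_extreme[OF e cones(2) cones(1) trans[OF add.commute sum]] .
  have cancel: "\<exists>c\<ge>0. v = c *\<^sub>Q e" if ex: "\<exists>d\<ge>0. r *\<^sub>Q v = d *\<^sub>Q e" and r: "0 \<le> r" "r \<noteq> 0" for r v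
  proof -
    obtain d where d: "0 \<le> d" "r *\<^sub>Q v = d *\<^sub>Q e" using ex by blast
    have "v = (1 / r) *\<^sub>Q (r *\<^sub>Q v)" using r by simp
    then have "v = (1 / r) *\<^sub>Q (d *\<^sub>Q e)" unfolding d(2) .
    then show ?thesis using d r by (intro exI[of _ "d / r"]) simp
  qed
  show "a \<in> ray_face e" "b \<in> ray_face e"
    unfolding ray_face_def using cancel[OF 1] cancel[OF 2] u(2,3) u01 ab by simp_all
qed (auto simp: ray_face_def)

lemma ray_face_edge:
  assumes e: "e \<in> E"
  shows "ray_face e \<in> edges_at P p"
proof -
  obtain c where c: "0 < c" "p - c *\<^sub>Q e \<in> P" using ray_feasible[OF e] by blast
  let ?D = "{x - y | x y. x \<in> ray_face e \<and> y \<in> ray_face e}"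
  have p: "p \<in> ray_face e" using p_in_P by (auto simp: ray_face_def intro!: exI[of _ 0])
  have q: "p - c *\<^sub>Q e \<in> ray_face e" using c by (auto simp: ray_face_def intro!: exI[of _ c])
  have "?D \<subseteq> span {e}"
  proof
    fix z assume "z \<in> ?D"
    then obtain x y a b where "z = x - y" "p - x = a *\<^sub>Q e" "p - y = b *\<^sub>Q e"
      unfolding ray_face_def by blast
    then have "z = (b - a) *\<^sub>Q e" by (simp add: scale_left_diff_distrib flip: \<open>p - x = _\<close> \<open>p - y = _\<close>)
    then show "z \<in> span {e}" by (simp add: span_base span_scale)
  qed
  moreover have "{e} \<subseteq> span ?D"
  proof -
    have "c *\<^sub>Q e \<in> ?D" using p q by force
    then have "(1/c) *\<^sub>Q (c *\<^sub>Q e) \<in> span ?D" by (intro span_scale span_base)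
    then show ?thesis using c by simp
  qed
  ultimately have "span ?D = span {e}"
    by (metis (no_types, lifting) span_eq)
  moreover have "independent {e}" using e ray_nonzero by (auto simp: dependent_single)
  ultimately have "dim ?D = 1" using dim_eq_card[of "{e}" ?D] by simp
  then show ?thesis
    unfolding edges_at_def edge_of_def aff_dim_def using p ray_face_face[OF e] by auto
qed

text \<open>A direction of the edge splits off a positive multiple of some \<open>e\<close>. The face property then puts
  a point of the ray of \<open>e\<close> into the edge, which has room for one line only.\<close>

lemma edge_is_ray_face:
  assumes F: "F \<in> edges_at P p"
  shows "\<exists>e\<in>E. F = ray_face e"
proof -
  let ?D = "{x - y | x y. x \<in> F \<and> y \<in> F}"
  have F: "face_of F P" "aff_dim F = 1" "p \<in> F"
    using assms by (auto simp: edges_at_def edge_of_def)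
  have FP: "F \<subseteq> P" and convex_F: "convex F" using F unfolding face_of_def by auto
  have face: "a \<in> F \<and> b \<in> F" if "a \<in> P" "b \<in> P" "x \<in> F" "x \<in> open_segment a b" for a b x
    using F(1) that unfolding face_of_def by blast
  have dim: "dim ?D = 1" using F(2,3) unfolding aff_dim_def by (auto split: if_splits)
  have "\<exists>x\<in>F. x \<noteq> p"
  proof (rule ccontr)
    assume "\<not> ?thesis"
    then have "x - y = 0" if "x \<in> F" "y \<in> F" for x y using that by (metis diff_self)
    then have "?D \<subseteq> span {}" by auto
    then have "dim ?D \<le> card ({}::'v set)" by (rule dim_le_card) simp
    with dim show False by simp
  qed
  then obtain x where x: "x \<in> F" "x \<noteq> p" by blast
  then have "p - x \<in> cone E" "p - x \<noteq> 0" using FP direction_in_cone by auto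
  then obtain e c y where e: "e \<in> E" "0 < c" "y \<in> cone E" "p - x = c *\<^sub>Q e + y"
    using cone_split_ray by blast
  obtain a where a: "0 < a" "p - a *\<^sub>Q y \<in> P"
    using convex_cone_steps[OF convex_P p_in_P ray_feasible e(3)] by blast
  obtain b where b: "0 < b" "p - b *\<^sub>Q e \<in> P" using ray_feasible[OF e(1)] by blast
  \<comment> \<open>A short step from \<open>p\<close> towards \<open>x\<close> is the midpoint of a step along \<open>e\<close> and a step along \<open>y\<close>.\<close>
  define d where "d = min (1/2) (min (a / 2) (b / (2 * c)))"
  have d: "0 < d" "d \<le> 1/2" "2 * d \<le> a" using a b e by (auto simp: d_def)
  have "d \<le> b / (2 * c)" by (simp add: d_def)
  then have dc: "2 * d * c \<le> b" using e(2) by (simp add: field_simps)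
  let ?y = "p - (2 * d) *\<^sub>Q y" and ?e = "p - (2 * d * c) *\<^sub>Q e" and ?m = "p - d *\<^sub>Q (p - x)"
  have y: "?y \<in> P" using convex_shorten[OF convex_P p_in_P a(2)] d by simp
  have e': "?e \<in> P" using convex_shorten[OF convex_P p_in_P b(2)] d dc e(2) by simp
  have m: "?m \<in> F"
    using convex_shorten[OF convex_F F(3), of 1 "p - x" d] x d by simp
  have half: "?m = (1 - 1/2) *\<^sub>Q ?e + (1/2) *\<^sub>Q ?y"
  proof -
    have "(1 - 1/2) *\<^sub>Q ?e + (1/2) *\<^sub>Q ?y = (1/2 + 1/2) *\<^sub>Q p - d *\<^sub>Q (c *\<^sub>Q e + y)"
      unfolding scale_left_distrib by (simp add: scale_right_diff_distrib scale_right_distrib)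
    then show ?thesis using e(4) by simp
  qed
  have eF: "?e \<in> F"
  proof (cases "?m = ?e \<or> ?m = ?y")
    case True
    have "?e = ?m" 
    proof (cases "?m = ?e")
      case False
      then have "?m = ?y" using True by blast
      then have "(1 - 1/2) *\<^sub>Q ?e + (1/2) *\<^sub>Q ?y = (1 - 1/2) *\<^sub>Q ?y + (1/2) *\<^sub>Q ?y"
        using half by (metis scale_left_distrib diff_add_cancel scale_one)
      then have "(1/2) *\<^sub>Q ?e = (1/2) *\<^sub>Q ?y" by simp
      then show ?thesis using \<open>?m = ?y\<close> by (metis scale_left_imp_eq zero_neq_one divide_eq_0_iff zero_neq_numeral)
    qed simp
    then show ?thesis using m by simp
  next
    case False
    then have "?m \<in> open_segment ?e ?y"
      unfolding open_segment_def using half by (intro DiffI CollectI exI[of _ "1/2"]) auto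
    then show ?thesis using face[OF e' y m] by blast
  qed
  define r where "r = 2 * d * c"
  have r: "0 < r" "p - r *\<^sub>Q e \<in> F" using d e(2) eF by (auto simp: r_def)
  have "e \<noteq> 0" using e(1) ray_nonzero by blast
  have "r *\<^sub>Q e \<in> ?D" using r(2) F(3) by force
  then have "(1/r) *\<^sub>Q (r *\<^sub>Q e) \<in> span ?D" by (intro span_scale span_base)
  then have eD: "e \<in> span ?D" using r by simp
  have line: "\<exists>k. z = k *\<^sub>Q e" if "z \<in> ?D" for z
  proof (rule ccontr)
    assume no: "\<not> ?thesis"
    then have "z \<notin> span {e}" by (auto simp: span_singleton)
    then have "independent {z, e}" using \<open>e \<noteq> 0\<close>
      by (simp add: independent_insert dependent_single)
    moreover have "z \<noteq> e" using no by (metis scale_one)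
    moreover obtain B where B: "B \<subseteq> ?D" "independent B" "?D \<subseteq> span B" "card B = dim ?D"
      using basis_exists by blast
    have "finite B" using B(4) dim by (metis card.infinite zero_neq_one)
    moreover have "{z, e} \<subseteq> span B"
      using that eD B(3) span_minimal[OF B(3) subspace_span] by blast
    ultimately have "card {z, e} \<le> card B"
      using independent_span_bound by blast
    then show False using \<open>z \<noteq> e\<close> B(4) dim by simp
  qed
  have "F \<subseteq> ray_face e"
  proof
    fix z assume z: "z \<in> F"
    then have "p - z \<in> ?D" using F(3) by blast
    then obtain k where k: "p - z = k *\<^sub>Q e" using line by blast
    have "p - z \<in> cone E" using z FP direction_in_cone by blast
    have "0 \<le> k"
    proof (rule ccontr)
      assume "\<not> 0 \<le> k"
      then have "- (p - z) \<in> cone E" using k cone_ray[OF e(1), of "- k"] by simp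
      with \<open>p - z \<in> cone E\<close> have "p - z = 0" using cone_pointed by blast
      with k \<open>e \<noteq> 0\<close> \<open>\<not> 0 \<le> k\<close> show False by simp
    qed
    then show "z \<in> ray_face e" using k z FP by (auto simp: ray_face_def)
  qed
  moreover have "ray_face e \<subseteq> F"
  proof
    fix z assume "z \<in> ray_face e"
    then obtain k where k: "z \<in> P" "0 \<le> k" "p - z = k *\<^sub>Q e" unfolding ray_face_def by blast
    then have z: "z = p - k *\<^sub>Q e" by (simp add: algebra_simps)
    show "z \<in> F"
    proof (cases "k \<le> r")
      case True
      then show ?thesis using convex_shorten[OF convex_F F(3) r(2)] k(2) z by simp
    next
      case False
      have "p - r *\<^sub>Q e = (1 - r / k) *\<^sub>Q p + (r / k) *\<^sub>Q z"
        unfolding z using False r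
        by (simp add: scale_right_diff_distrib scale_left_diff_distrib)
      moreover have "p - r *\<^sub>Q e \<noteq> p" "p - r *\<^sub>Q e \<noteq> z"
        using False r \<open>e \<noteq> 0\<close> by (auto simp: z)
      ultimately have "p - r *\<^sub>Q e \<in> open_segment p z"
        unfolding open_segment_def using False r
        by (intro DiffI CollectI exI[of _ "r / k"]) auto
      then show ?thesis using face[OF p_in_P k(1) r(2)] by blast
    qed
  qed
  ultimately show ?thesis using e(1) by blast
qed

lemma card_edges_at: "card (edges_at P p) = card E"
proof -
  have "bij_betw ray_face E (edges_at P p)"
    unfolding bij_betw_def
  proof
    show "inj_on ray_face E"
    proof (rule inj_onI)
      fix e f assume ef: "e \<in> E" "f \<in> E" "ray_face e = ray_face f"
      obtain c where c: "0 < c" "p - c *\<^sub>Q e \<in> P" using ray_feasible[OF ef(1)] by blast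
      then have "p - c *\<^sub>Q e \<in> ray_face e" by (auto simp: ray_face_def intro!: exI[of _ c])
      then obtain d where d: "c *\<^sub>Q e = d *\<^sub>Q f" using ef(3) unfolding ray_face_def by auto
      have "e = (1 / c) *\<^sub>Q (c *\<^sub>Q e)" using c(1) by simp
      then have "e = (1 / c) *\<^sub>Q (d *\<^sub>Q f)" unfolding d .
      then have "e = (d / c) *\<^sub>Q f" by simp
      then show "e = f" using rays_distinct ef by blast
    qed
    show "ray_face ` E = edges_at P p"
      using ray_face_edge edge_is_ray_face by blast
  qed
  then show ?thesis using bij_betw_same_card by metis
qed

end

section \<open>Simple roots and simple reflections\<close>

context weyl_group
begin

lemma finite_base: "finite \<Delta>"
  using base_subset finite_roots finite_subset by blast

sublocale base: finite_dimensional_vector_space scale \<Delta>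
  by unfold_locales (use finite_base base_independent base_span in auto)

lemma base_nonzero: "a \<in> \<Delta> \<Longrightarrow> a \<noteq> 0"
  using base_subset zero_not_root by blast

lemma form_add_right: "form z (x + y) = form z x + form z y"
  by (metis form_add form_sym)

lemma form_scale_right: "form z (c *\<^sub>Q x) = c * form z x"
  by (metis form_scale form_sym)

lemma form_zero [simp]: "form 0 x = 0" "form x 0 = 0"
  using form_scale[of 0 x x] form_scale_right[of x 0 x] by simp_all

lemma form_minus [simp]: "form (- x) y = - form x y" "form y (- x) = - form y x"
  using form_add[of x "- x" y] form_add_right[of y x "- x"] by simp_all

lemma form_diff: "form (x - y) z = form x z - form y z" "form z (x - y) = form z x - form z y"
  using form_add[of x "- y" z] form_add_right[of z x "- y"] by simp_all

lemmas form_linear = form_add form_add_right form_diff form_scale form_scale_right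

lemma form_self_pos: "a \<in> \<Delta> \<Longrightarrow> form a a > 0"
  using base_nonzero form_pos by blast

lemma reflection_add: "reflection a (x + y) = reflection a x + reflection a y"
  unfolding reflection_def by (simp add: form_add add_divide_distrib distrib_left scale_left_distrib)

lemma reflection_scale: "reflection a (c *\<^sub>Q x) = c *\<^sub>Q reflection a x"
  unfolding reflection_def by (simp add: form_scale scale_right_diff_distrib mult.left_commute)

lemma reflection_diff: "reflection a (x - y) = reflection a x - reflection a y"
  unfolding reflection_def by (simp add: form_diff diff_divide_distrib right_diff_distrib scale_left_diff_distrib)

lemma reflection_zero [simp]: "reflection a 0 = 0"
  by (simp add: reflection_def)

lemma reflection_self: "form a a \<noteq> 0 \<Longrightarrow> reflection a a = - a"
  unfolding reflection_def using scale_left_diff_distrib[of 1 2 a] by simp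

lemma reflection_reflection [simp]: "reflection a (reflection a x) = x"
proof (cases "a = 0")
  case True
  then show ?thesis by (simp add: reflection_def)
next
  case False
  then have "form a a \<noteq> 0" using form_pos by fastforce
  then have "reflection a (reflection a x) = reflection a x - (2 * form x a / form a a) *\<^sub>Q (- a)"
    by (simp add: reflection_def[of a x] reflection_diff reflection_scale reflection_self)
  then show ?thesis by (simp add: reflection_def)
qed

lemma reflection_involution: "reflection a \<circ> reflection a = id"
  by auto

lemma form_reflection: "form (reflection a x) y = form x (reflection a y)"
  unfolding reflection_def by (simp add: form_linear form_sym[of a y])

lemma form_reflections: "form (reflection a x) (reflection a y) = form x y"
  by (simp add: form_reflection)

lemma reflection_conjugate:
  "reflection (reflection a b) x = reflection a (reflection b (reflection a x))"
proof -
  have "reflection a (reflection b (reflection a x))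
      = x - (2 * form (reflection a x) b / form b b) *\<^sub>Q reflection a b"
    unfolding reflection_def[of b] by (simp add: reflection_diff reflection_scale)
  then show ?thesis
    unfolding reflection_def[of "reflection a b" x]
    by (simp add: form_reflections form_reflection)
qed

lemma reflection_multiple:
  assumes "c \<noteq> 0"
  shows "reflection (c *\<^sub>Q a) = reflection a"
proof
  fix x
  show "reflection (c *\<^sub>Q a) x = reflection a x"
    unfolding reflection_def using assms by (simp add: form_linear)
qed

lemma reflection_fixed_iff:
  assumes "a \<noteq> 0"
  shows "reflection a x = x \<longleftrightarrow> form x a = 0"
  unfolding reflection_def using form_pos[OF assms] assms by auto

abbreviation coef :: "'v \<Rightarrow> 'v \<Rightarrow> rat" where
  "coef \<equiv> representation \<Delta>"

definition nonneg :: "'v \<Rightarrow> bool" where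
  "nonneg x \<longleftrightarrow> (\<forall>a\<in>\<Delta>. coef x a \<ge> 0)"

lemma coef_base: "a \<in> \<Delta> \<Longrightarrow> coef a b = (if b = a then 1 else 0)"
  by (simp add: representation_basis[OF base_independent])

lemma coef_add: "coef (x + y) a = coef x a + coef y a"
  by (simp add: representation_add[OF base_independent] base_span)

lemma coef_scale: "coef (c *\<^sub>Q x) a = c * coef x a"
  by (simp add: representation_scale[OF base_independent] base_span)

lemma coef_zero: "coef 0 a = 0"
  using coef_scale[of 0 0 a] by simp

lemma coef_minus: "coef (- x) a = - coef x a"
  using coef_add[of x "- x" a] by (simp add: coef_zero)

lemma coef_diff: "coef (x - y) a = coef x a - coef y a"
  using coef_add[of x "- y" a] by (simp add: coef_minus)

lemmas coef_simps = coef_add coef_scale coef_zero coef_minus coef_diff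

lemma coef_expansion: "(\<Sum>a\<in>\<Delta>. coef x a *\<^sub>Q a) = x"
  by (rule sum_representation_eq[OF base_independent]) (auto simp: base_span finite_base)

lemma coef_eqI: "(\<And>a. a \<in> \<Delta> \<Longrightarrow> coef x a = coef y a) \<Longrightarrow> x = y"
  by (metis (no_types, lifting) coef_expansion sum.cong)

lemma coef_sum:
  assumes "b \<in> \<Delta>"
  shows "coef (\<Sum>a\<in>\<Delta>. k a *\<^sub>Q a) b = k b"
proof -
  have "coef (\<Sum>a\<in>A. k a *\<^sub>Q a) b = (if b \<in> A then k b else 0)" if "finite A" "A \<subseteq> \<Delta>" for A
    using that by induction (auto simp: coef_simps coef_base)
  then show ?thesis using finite_base assms by simp
qed

lemma root_sign:
  assumes "\<beta> \<in> \<Phi>"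
  shows "nonneg \<beta> \<or> nonneg (- \<beta>)"
proof -
  obtain k :: "'v \<Rightarrow> nat" where
    k: "\<beta> = (\<Sum>a\<in>\<Delta>. of_nat (k a) *\<^sub>Q a) \<or> \<beta> = - (\<Sum>a\<in>\<Delta>. of_nat (k a) *\<^sub>Q a)"
    using base_roots[OF assms] by blast
  then show ?thesis unfolding nonneg_def by (auto simp: coef_sum coef_minus)
qed

lemma root_positiveI:
  assumes "\<beta> \<in> \<Phi>" "a \<in> \<Delta>" "coef \<beta> a > 0"
  shows "nonneg \<beta>"
  using root_sign[OF assms(1)] assms(2,3) unfolding nonneg_def by (auto simp: coef_minus)

lemma coef_reflection: "a \<in> \<Delta> \<Longrightarrow> b \<noteq> a \<Longrightarrow> coef (reflection a x) b = coef x b"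
  unfolding reflection_def by (simp add: coef_simps coef_base)

lemma reflection_in_roots: "a \<in> \<Delta> \<Longrightarrow> \<beta> \<in> \<Phi> \<Longrightarrow> reflection a \<beta> \<in> \<Phi>"
  unfolding reflection_def using base_subset reflection_root by blast

text \<open>A positive root other than \<open>a\<close> is not a multiple of \<open>a\<close>, so it has a positive coefficient
  that the reflection in \<open>a\<close> leaves alone.\<close>

lemma simple_reflection_positive_root:
  assumes a: "a \<in> \<Delta>" and \<beta>: "\<beta> \<in> \<Phi>" "nonneg \<beta>" "\<beta> \<noteq> a"
  shows "nonneg (reflection a \<beta>)"
proof -
  have "\<exists>b\<in>\<Delta>. b \<noteq> a \<and> coef \<beta> b > 0"
  proof (rule ccontr)
    assume none: "\<not> ?thesis"
    have "\<beta> = coef \<beta> a *\<^sub>Q a"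
    proof (rule coef_eqI)
      fix b assume "b \<in> \<Delta>"
      then show "coef \<beta> b = coef (coef \<beta> a *\<^sub>Q a) b"
        using none \<beta>(2) a unfolding nonneg_def by (auto simp: coef_scale coef_base order_le_less)
    qed
    moreover from this have "coef \<beta> a = 1 \<or> coef \<beta> a = -1"
      using reduced[of a "coef \<beta> a"] a \<beta>(1) base_subset by auto
    moreover have "coef \<beta> a \<ge> 0" using \<beta>(2) a unfolding nonneg_def by blast
    ultimately show False using \<beta>(3) by auto
  qed
  then show ?thesis
    using root_positiveI reflection_in_roots a \<beta>(1) coef_reflection by metis
qed

lemma form_base_nonpos:
  assumes "a \<in> \<Delta>" "b \<in> \<Delta>" "a \<noteq> b"
  shows "form a b \<le> 0"
proof -
  have "nonneg (reflection a b)"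
    using simple_reflection_positive_root[of a b] assms base_subset
    by (auto simp: nonneg_def coef_base)
  then have "coef (reflection a b) a \<ge> 0" using assms unfolding nonneg_def by blast
  then have "form b a / form a a \<le> 0"
    using assms by (simp add: reflection_def coef_simps coef_base)
  then show ?thesis
    using form_self_pos[OF assms(1)] by (simp add: divide_le_0_iff form_sym)
qed

text \<open>Adjacent simple roots satisfy \<open>- 2 (a, b) \<ge> max (a, a) (b, b)\<close> by integrality. Hence
  \<open>a + b + c\<close> would have nonpositive norm for three pairwise adjacent simple roots.\<close>

lemma no_triangle:
  assumes abc: "a \<in> \<Delta>" "b \<in> \<Delta>" "c \<in> \<Delta>" "a \<noteq> b" "b \<noteq> c" "a \<noteq> c"
    and adj: "form a b \<noteq> 0" "form b c \<noteq> 0" "form a c \<noteq> 0"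
  shows False
proof -
  have bound: "- 2 * form x y \<ge> form x x"
    if "x \<in> \<Delta>" "y \<in> \<Delta>" "x \<noteq> y" "form x y \<noteq> 0" for x y
  proof -
    have neg: "form x y < 0" using form_base_nonpos that by (metis order_le_less)
    have "2 * form y x / form x x \<in> \<int>" using crystallographic that base_subset by blast
    then obtain n where n: "2 * form y x / form x x = of_int n" by (auto elim: Ints_cases)
    have pos: "form x x > 0" using that form_self_pos by blast
    have "2 * form y x / form x x < 0" using neg pos by (simp add: form_sym[of y x] divide_neg_pos)
    then have "n \<le> -1" using n by simp
    then have "2 * form y x / form x x \<le> - 1" using n by simp
    then show ?thesis using pos by (simp add: form_sym[of y x] field_simps)
  qed
  have "form (a + b + c) (a + b + c)
      = form a a + form b b + form c c + 2 * form a b + 2 * form b c + 2 * form a c"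
    by (simp add: form_add form_add_right form_sym[of b a] form_sym[of c a] form_sym[of c b])
  also have "\<dots> \<le> 0"
    using bound[of a b] bound[of b c] bound[of c a] abc adj by (simp add: form_sym[of c a])
  finally have "a + b + c = 0" using form_pos by (metis not_le)
  then have "coef (a + b + c) a = 0" by (simp add: coef_zero)
  then show False using abc by (simp add: coef_add coef_base)
qed

lemma inj_reflection: "inj_on reflection \<Delta>"
proof (rule inj_onI)
  fix a b assume ab: "a \<in> \<Delta>" "b \<in> \<Delta>" "reflection a = reflection b"
  then have "reflection b a = - a" using reflection_self[of a] form_self_pos by fastforce
  then have "coef (reflection b a) a = - 1" using ab by (simp add: coef_minus coef_base)
  then show "a = b" using coef_reflection[of b a a] ab by (auto simp: coef_base split: if_splits)
qed

lemma reflections_commute_iff: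
  assumes "a \<in> \<Delta>" "b \<in> \<Delta>" "a \<noteq> b"
  shows "reflection a \<circ> reflection b = reflection b \<circ> reflection a \<longleftrightarrow> form a b = 0"
proof
  assume "form a b = 0"
  then show "reflection a \<circ> reflection b = reflection b \<circ> reflection a"
    unfolding reflection_def by (auto simp: form_linear form_sym[of b a])
next
  assume comm: "reflection a \<circ> reflection b = reflection b \<circ> reflection a"
  have "reflection a (reflection b a) = reflection b (- a)"
    using fun_cong[OF comm, of a] reflection_self[of a] form_self_pos[OF assms(1)] by simp
  moreover have "coef (reflection a (reflection b a)) b = coef (reflection b a) b"
    using coef_reflection assms by metis
  moreover have "reflection b (- a) = - reflection b a"
    using reflection_scale[of b "-1" a] by simp
  ultimately have "coef (reflection b a) b = 0" by (simp add: coef_minus)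
  then show "form a b = 0"
    using assms form_self_pos[OF assms(2)] by (simp add: reflection_def coef_simps coef_base)
qed

section \<open>Words in the simple reflections\<close>

lemma foldr_reflection_add:
  "foldr reflection as (x + y) = foldr reflection as x + foldr reflection as y"
  by (induction as) (simp_all add: reflection_add)

lemma foldr_reflection_scale:
  "foldr reflection as (c *\<^sub>Q x) = c *\<^sub>Q foldr reflection as x"
  by (induction as) (simp_all add: reflection_scale)

lemma foldr_reflection_rev: "foldr reflection (rev as) (foldr reflection as x) = x"
  by (induction as arbitrary: x) simp_all

lemma simple_reflections_Bij: "reflection a \<in> Bij UNIV"
  unfolding Bij_def
  by (auto intro!: bij_betw_byWitness[where f' = "reflection a"])

lemma BijGroup_UNIV_mult:
  "f \<in> Bij UNIV \<Longrightarrow> g \<in> Bij UNIV \<Longrightarrow> f \<otimes>\<^bsub>BijGroup UNIV\<^esub> g = f \<circ> g"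
  by (auto simp: BijGroup_def compose_def)

lemma BijGroup_UNIV_one: "\<one>\<^bsub>BijGroup UNIV\<^esub> = id"
  by (auto simp: BijGroup_def)

lemma foldr_reflection_Bij: "foldr reflection as \<in> Bij UNIV"
  unfolding Bij_def
  by (auto intro!: bij_betw_byWitness[where f' = "foldr reflection (rev as)"] simp: foldr_reflection_rev)
    (metis foldr_reflection_rev rev_rev_ident)

lemma W_words: "W = {foldr reflection as | as. set as \<subseteq> \<Delta>}"
proof (intro equalityI subsetI)
  fix w assume "w \<in> W"
  then show "w \<in> {foldr reflection as | as. set as \<subseteq> \<Delta>}"
    unfolding W_def
  proof induction
    case one
    show ?case by (intro CollectI exI[of _ "[]"]) (simp add: BijGroup_UNIV_one id_def)
  next
    case (incl h)
    then obtain a where "a \<in> \<Delta>" "h = reflection a" unfolding simple_reflections_def by blast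
    then show ?case by (intro CollectI exI[of _ "[a]"]) (simp add: fun_eq_iff)
  next
    case (inv h)
    then obtain a where a: "a \<in> \<Delta>" "h = reflection a" unfolding simple_reflections_def by blast
    have "inv\<^bsub>BijGroup UNIV\<^esub> h = h"
      by (rule group.inv_equality[OF group_BijGroup])
        (simp_all add: a BijGroup_UNIV_mult BijGroup_UNIV_one simple_reflections_Bij reflection_involution,
         simp_all add: BijGroup_def simple_reflections_Bij)
    then show ?case using a by (intro CollectI exI[of _ "[a]"]) simp
  next
    case (eng g h)
    then obtain as bs where *: "set as \<subseteq> \<Delta>" "g = foldr reflection as" "set bs \<subseteq> \<Delta>" "h = foldr reflection bs"
      by blast
    then have "g \<otimes>\<^bsub>BijGroup UNIV\<^esub> h = foldr reflection (as @ bs)"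
      by (intro ext) (simp add: BijGroup_UNIV_mult foldr_reflection_Bij)
    then show ?case using * by (intro CollectI exI[of _ "as @ bs"]) simp
  qed
next
  fix w assume "w \<in> {foldr reflection as | as. set as \<subseteq> \<Delta>}"
  then obtain as where "set as \<subseteq> \<Delta>" "w = foldr reflection as" by blast
  then show "w \<in> W"
  proof (induction as arbitrary: w)
    case Nil
    then show ?case
      unfolding W_def using generate.one[of "BijGroup UNIV" simple_reflections]
      by (simp add: BijGroup_UNIV_one id_def)
  next
    case (Cons a as)
    have "reflection a \<otimes>\<^bsub>BijGroup UNIV\<^esub> foldr reflection as \<in> W"
      unfolding W_def
    proof (rule generate.eng)
      show "reflection a \<in> generate (BijGroup UNIV) simple_reflections"
        using Cons by (intro generate.incl) (simp add: simple_reflections_def)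
      show "foldr reflection as \<in> generate (BijGroup UNIV) simple_reflections"
        using Cons unfolding W_def by simp
    qed
    then show ?case
      using Cons by (simp add: BijGroup_UNIV_mult simple_reflections_Bij foldr_reflection_Bij comp_def)
  qed
qed

text \<open>The exchange property, for a dominant vector instead of a group element: if the
  hyperplane of a positive root separates \<open>w x\<close> from the chamber, then reflecting \<open>w x\<close>
  in it amounts to deleting a letter from a word for \<open>w\<close>.\<close>

lemma exchange:
  assumes x: "x \<in> chamber" and "set as \<subseteq> \<Delta>" "\<beta> \<in> \<Phi>" "nonneg \<beta>"
    and "form (foldr reflection as x) \<beta> < 0"
  shows "\<exists>bs. set bs \<subseteq> \<Delta> \<and> length bs < length as \<and>
           foldr reflection bs x = reflection \<beta> (foldr reflection as x)"
  using assms(2-)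
proof (induction as arbitrary: \<beta>)
  case Nil
  have "form x \<beta> = (\<Sum>a\<in>\<Delta>. coef \<beta> a * form x a)"
  proof -
    have "form x (\<Sum>a\<in>A. coef \<beta> a *\<^sub>Q a) = (\<Sum>a\<in>A. coef \<beta> a * form x a)" if "finite A" for A
      using that by induction (simp_all add: form_linear)
    from this[OF finite_base] show ?thesis by (simp add: coef_expansion)
  qed
  also have "\<dots> \<ge> 0"
    using x Nil(3) unfolding chamber_def nonneg_def by (intro sum_nonneg) auto
  finally show ?case using Nil(4) by simp
next
  case (Cons a as)
  let ?y = "foldr reflection as x"
  show ?case
  proof (cases "\<beta> = a")
    case True
    then show ?thesis using Cons.prems by (intro exI[of _ as]) simp
  next
    case False
    have "form ?y (reflection a \<beta>) < 0"
      using Cons.prems by (simp add: form_reflection)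
    moreover have "nonneg (reflection a \<beta>)" "reflection a \<beta> \<in> \<Phi>"
      using Cons.prems False simple_reflection_positive_root reflection_in_roots by simp_all
    ultimately obtain bs where bs: "set bs \<subseteq> \<Delta>" "length bs < length as"
        "foldr reflection bs x = reflection (reflection a \<beta>) ?y"
      using Cons.IH[of "reflection a \<beta>"] Cons.prems(1) by auto
    then have "foldr reflection (a # bs) x = reflection \<beta> (foldr reflection (a # as) x)"
      by (simp add: reflection_conjugate)
    then show ?thesis using bs Cons.prems(1) by (intro exI[of _ "a # bs"]) simp
  qed
qed

text \<open>An element of \<open>W\<close> is linear, so its values on the base determine it, and these values are
  roots.\<close>

lemma finite_orbit: "finite {w x | w. w \<in> W}"
proof -
  have lin: "w x = (\<Sum>a\<in>\<Delta>. coef x a *\<^sub>Q w a)" if w: "w \<in> W" for w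
  proof -
    obtain as where as: "w = foldr reflection as" using w unfolding W_words by blast
    have "w (\<Sum>a\<in>A. coef x a *\<^sub>Q a) = (\<Sum>a\<in>A. coef x a *\<^sub>Q w a)" if "finite A" for A
      using that
    proof induction
      case empty
      show ?case using foldr_reflection_scale[of as 0 0] by (simp add: as)
    qed (simp add: as foldr_reflection_add foldr_reflection_scale)
    from this[OF finite_base] show ?thesis by (simp add: coef_expansion)
  qed
  have roots: "w a \<in> \<Phi>" if w: "w \<in> W" and a: "a \<in> \<Delta>" for w a
  proof -
    obtain as where "set as \<subseteq> \<Delta>" "w = foldr reflection as" using w unfolding W_words by blast
    moreover from this(1) have "foldr reflection as a \<in> \<Phi>"
      using a base_subset by (induction as) (auto simp: reflection_in_roots)
    ultimately show ?thesis by simp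
  qed
  have "{w x | w. w \<in> W} \<subseteq> (\<lambda>f. \<Sum>a\<in>\<Delta>. coef x a *\<^sub>Q f a) ` (\<Delta> \<rightarrow>\<^sub>E \<Phi>)"
  proof
    fix y assume "y \<in> {w x | w. w \<in> W}"
    then obtain w where w: "w \<in> W" "y = w x" by blast
    have "restrict w \<Delta> \<in> \<Delta> \<rightarrow>\<^sub>E \<Phi>" using roots w by auto
    moreover have "y = (\<Sum>a\<in>\<Delta>. coef x a *\<^sub>Q restrict w \<Delta> a)" using lin w by simp
    ultimately show "y \<in> (\<lambda>f. \<Sum>a\<in>\<Delta>. coef x a *\<^sub>Q f a) ` (\<Delta> \<rightarrow>\<^sub>E \<Phi>)" by blast
  qed
  moreover have "finite (\<Delta> \<rightarrow>\<^sub>E \<Phi>)" by (intro finite_PiE finite_base finite_roots)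
  ultimately show ?thesis using finite_surj by blast
qed

end

section \<open>Edge directions at a dominant vertex\<close>

locale dominant_vector = weyl_group scale form \<Phi> \<Delta>
  for scale :: "rat \<Rightarrow> 'v::ab_group_add \<Rightarrow> 'v" (infixr "*\<^sub>Q" 75)
    and form :: "'v \<Rightarrow> 'v \<Rightarrow> rat" and \<Phi> \<Delta> :: "'v set" +
  fixes lam :: 'v
  assumes dominant: "lam \<in> chamber"
begin

definition fixing_roots :: "'v set" where
  "fixing_roots = {a \<in> \<Delta>. form lam a = 0}"

abbreviation moving_roots :: "'v set" where
  "moving_roots \<equiv> \<Delta> - fixing_roots"

lemma fixing_rootsD: "g \<in> fixing_roots \<Longrightarrow> g \<in> \<Delta>" "g \<in> fixing_roots \<Longrightarrow> form lam g = 0"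
  by (simp_all add: fixing_roots_def)

lemma moving_root_pos: "a \<in> moving_roots \<Longrightarrow> form lam a > 0"
  using dominant by (fastforce simp: fixing_roots_def chamber_def)

lemma reflection_fixes_lam: "g \<in> fixing_roots \<Longrightarrow> reflection g lam = lam"
  using reflection_fixed_iff base_nonzero fixing_rootsD by blast

text \<open>The union of the orbits of the elements of \<open>A\<close> under the subgroup generated by the fixing
  reflections. As an inductive set it needs no words in these reflections.\<close>

inductive_set stabilizer_orbit :: "'v set \<Rightarrow> 'v set" for A :: "'v set" where
  start: "a \<in> A \<Longrightarrow> a \<in> stabilizer_orbit A"
| step: "x \<in> stabilizer_orbit A \<Longrightarrow> g \<in> fixing_roots \<Longrightarrow> reflection g x \<in> stabilizer_orbit A"

abbreviation edge_directions :: "'v set" where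
  "edge_directions \<equiv> stabilizer_orbit moving_roots"

lemma edge_directions_Union: "edge_directions = (\<Union>a\<in>moving_roots. stabilizer_orbit {a})"
proof
  show "edge_directions \<subseteq> (\<Union>a\<in>moving_roots. stabilizer_orbit {a})"
  proof
    fix x assume "x \<in> edge_directions"
    then show "x \<in> (\<Union>a\<in>moving_roots. stabilizer_orbit {a})"
      by induction (auto intro: stabilizer_orbit.intros)
  qed
  show "(\<Union>a\<in>moving_roots. stabilizer_orbit {a}) \<subseteq> edge_directions"
  proof clarify
    fix x a assume "x \<in> stabilizer_orbit {a}" "a \<in> \<Delta>" "a \<notin> fixing_roots"
    then show "x \<in> edge_directions"
      by induction (auto intro: stabilizer_orbit.intros)
  qed
qed

text \<open>Fixing reflections only change coordinates at fixing roots. So the coordinates at moving roots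
  tell the orbits apart and show that all their elements are positive.\<close>

lemma coef_stabilizer_orbit:
  assumes "x \<in> stabilizer_orbit {a}" "b \<in> moving_roots"
  shows "coef x b = coef a b"
  using assms(1)
proof induction
  case (step x g)
  then show ?case using coef_reflection[of g b x] assms(2) fixing_rootsD by auto
qed simp

lemma stabilizer_orbit_in_directions:
  "a \<in> moving_roots \<Longrightarrow> x \<in> stabilizer_orbit {a} \<Longrightarrow> x \<in> edge_directions"
  unfolding edge_directions_Union by blast

lemma stabilizer_orbits_disjoint:
  assumes "a \<in> moving_roots" "b \<in> moving_roots" "x \<in> stabilizer_orbit {a}" "x \<in> stabilizer_orbit {b}"
  shows "a = b"
proof -
  have "coef a a = coef b a" using coef_stabilizer_orbit assms by metis
  then show ?thesis using assms by (simp add: coef_base split: if_splits)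
qed

lemma edge_direction_root:
  assumes "x \<in> edge_directions"
  shows "x \<in> \<Phi>"
  using assms
proof induction
  case (start a)
  then show ?case using base_subset by blast
next
  case (step x g)
  then show ?case using reflection_in_roots fixing_rootsD by blast
qed

lemma finite_edge_directions: "finite edge_directions"
  by (rule finite_subset[OF _ finite_roots]) (use edge_direction_root in blast)

lemma edge_direction_positive:
  assumes "x \<in> edge_directions"
  shows "nonneg x"
proof -
  obtain a where a: "a \<in> moving_roots" "x \<in> stabilizer_orbit {a}"
    using assms unfolding edge_directions_Union by blast
  then have "coef x a = 1" using coef_stabilizer_orbit coef_base by auto
  then show ?thesis using root_positiveI[of x a] a edge_direction_root[OF assms] by auto
qed

lemma edge_directions_distinct_rays:
  assumes "x \<in> edge_directions" "y \<in> edge_directions" "x = d *\<^sub>Q y"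
  shows "x = y"
proof -
  have "d = 1 \<or> d = -1" using reduced[of y d] edge_direction_root assms by blast
  moreover have "d \<noteq> -1"
  proof
    assume "d = -1"
    then have "nonneg (- y)" using edge_direction_positive[OF assms(1)] assms(3) by simp
    moreover have "nonneg y" by (rule edge_direction_positive) fact
    ultimately have "y = 0" by (intro coef_eqI) (fastforce simp: nonneg_def coef_minus coef_zero)
    then show False using edge_direction_root[OF assms(2)] zero_not_root by blast
  qed
  ultimately show ?thesis using assms(3) by auto
qed

lemma cone_nonneg: "x \<in> cone edge_directions \<Longrightarrow> nonneg x"
proof (induction rule: cone.induct)
  case (add_ray x e c)
  then show ?case using edge_direction_positive[of e] by (simp add: nonneg_def coef_simps)
qed (simp add: nonneg_def coef_zero)

lemma cone_reflection:
  assumes g: "g \<in> fixing_roots" and "x \<in> cone edge_directions"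
  shows "reflection g x \<in> cone edge_directions"
  using assms(2)
proof induction
  case (add_ray x e c)
  then show ?case
    using cone.add_ray[OF add_ray.IH stabilizer_orbit.step[OF add_ray(2) g]]
    by (simp add: reflection_add reflection_scale)
qed (simp add: cone.zero)

text \<open>A moving simple root spans an extreme ray already of the cone of all nonnegative
  combinations of simple roots; the stabilizer carries this to its whole orbit.\<close>

lemma edge_direction_extreme:
  assumes "e \<in> edge_directions" "v \<in> cone edge_directions" "w \<in> cone edge_directions"
    "v + w = c *\<^sub>Q e"
  shows "\<exists>d\<ge>0. v = d *\<^sub>Q e"
  using assms
proof (induction arbitrary: v w)
  case (start a)
  have v: "nonneg v" and w: "nonneg w" using start cone_nonneg by auto
  have "v = coef v a *\<^sub>Q a"
  proof (rule coef_eqI)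
    fix b assume b: "b \<in> \<Delta>"
    have "coef v b + coef w b = c * coef a b"
      using start(4) by (metis coef_add coef_scale)
    moreover have "coef v b \<ge> 0" "coef w b \<ge> 0" using v w b unfolding nonneg_def by auto
    ultimately show "coef v b = coef (coef v a *\<^sub>Q a) b"
      using start(1) by (auto simp: coef_scale coef_base split: if_splits)
  qed
  moreover have "coef v a \<ge> 0" using v start(1) unfolding nonneg_def by blast
  ultimately show ?case by blast
next
  case (step x g)
  have "reflection g v + reflection g w = c *\<^sub>Q x"
    using arg_cong[OF step(6), of "reflection g"] by (simp add: reflection_add reflection_scale)
  then obtain d where "0 \<le> d" "reflection g v = d *\<^sub>Q x"
    using step.IH[of "reflection g v" "reflection g w"] step cone_reflection by blast
  then have "v = d *\<^sub>Q reflection g x" by (metis reflection_reflection reflection_scale)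
  then show ?case using \<open>0 \<le> d\<close> by blast
qed

text \<open>The ray of a moving simple root \<open>a\<close> leads to \<open>reflection a lam\<close>, and the stabilizer of \<open>lam\<close>
  carries this to the orbit of \<open>a\<close>.\<close>

lemma edge_direction_feasible:
  assumes "e \<in> edge_directions"
  shows "\<exists>c>0. \<exists>w\<in>W. lam - c *\<^sub>Q e = w lam"
proof -
  have "\<exists>c>0. \<exists>as. set as \<subseteq> \<Delta> \<and> lam - c *\<^sub>Q e = foldr reflection as lam"
    using assms
  proof induction
    case (start a)
    then have "0 < 2 * form lam a / form a a" using moving_root_pos form_self_pos by simp
    moreover have "lam - (2 * form lam a / form a a) *\<^sub>Q a = foldr reflection [a] lam"
      by (simp add: reflection_def)
    ultimately show ?case using start
      by (intro exI[of _ "2 * form lam a / form a a"] conjI exI[of _ "[a]"]) simp_all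
  next
    case (step x g)
    then obtain c as where *: "0 < c" "set as \<subseteq> \<Delta>" "lam - c *\<^sub>Q x = foldr reflection as lam" by blast
    have "lam - c *\<^sub>Q reflection g x = reflection g (lam - c *\<^sub>Q x)"
      using step(2) by (simp add: reflection_diff reflection_scale reflection_fixes_lam)
    then have "lam - c *\<^sub>Q reflection g x = foldr reflection (g # as) lam" by (simp add: *(3))
    then show ?case using * step(2) fixing_rootsD
      by (intro exI[of _ c] conjI exI[of _ "g # as"]) simp_all
  qed
  then show ?thesis unfolding W_words by blast
qed

text \<open>Induction on the length of the word. If the outermost reflection belongs to a fixing root, it
  preserves \<open>lam\<close> and the cone. If it belongs to a moving root \<open>a\<close> and lowers the vector, the
  difference grows by a nonnegative multiple of \<open>a\<close>. If it raises the vector, the exchange property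
  yields a shorter word.\<close>

lemma orbit_below:
  assumes "set as \<subseteq> \<Delta>"
  shows "lam - foldr reflection as lam \<in> cone edge_directions"
  using assms
proof (induction as rule: length_induct)
  case (1 as)
  show ?case
  proof (cases as)
    case Nil
    then show ?thesis by (simp add: cone.zero)
  next
    case (Cons a bs)
    let ?y = "foldr reflection bs lam"
    have a: "a \<in> \<Delta>" and IH: "lam - ?y \<in> cone edge_directions"
      using 1 Cons by auto
    show ?thesis
    proof (cases "a \<in> fixing_roots")
      case True
      have "lam - reflection a ?y = reflection a (lam - ?y)"
        using True by (simp add: reflection_diff reflection_fixes_lam)
      then show ?thesis using cone_reflection[OF True IH] Cons by simp
    next
      case moving: False
      show ?thesis
      proof (cases "form ?y a < 0")
        case True
        have "nonneg a" "a \<in> \<Phi>" using a base_subset by (auto simp: nonneg_def coef_base)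
        then obtain cs where "set cs \<subseteq> \<Delta>" "length cs < length bs"
            "foldr reflection cs lam = reflection a ?y"
          using exchange[OF dominant _ _ _ True] 1(2) Cons by auto
        then show ?thesis using 1(1) Cons by (metis foldr.simps(2) comp_apply length_Cons less_SucI)
      next
        case False
        have eq: "lam - reflection a ?y = (lam - ?y) + (2 * form ?y a / form a a) *\<^sub>Q a"
          by (simp add: reflection_def)
        have "a \<in> edge_directions" using a moving by (intro stabilizer_orbit.start) simp
        moreover have "0 \<le> 2 * form ?y a / form a a" using False form_self_pos[OF a] by simp
        ultimately have "lam - reflection a ?y \<in> cone edge_directions"
          unfolding eq by (rule cone.add_ray[OF IH])
        then show ?thesis using Cons by simp
      qed
    qed
  qed
qed

lemma lam_in_orbit: "lam \<in> {w lam | w. w \<in> W}"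
  unfolding W_words by (intro CollectI exI[of _ id] conjI exI[of _ "[]"]) auto

sublocale vertex_cone scale "orbit_polytope lam" edge_directions lam
proof
  show "convex (orbit_polytope lam)" unfolding orbit_polytope_def by (rule convex_hull)
  show "lam \<in> orbit_polytope lam" unfolding orbit_polytope_def by (rule hull_inc[OF lam_in_orbit])
  show "0 \<notin> edge_directions" using edge_direction_root zero_not_root by blast
next
  fix x assume x: "x \<in> orbit_polytope lam"
  have "convex {x. lam - x \<in> cone edge_directions}"
    unfolding convex_def
  proof (intro ballI allI impI CollectI)
    fix x y u v assume *: "x \<in> {x. lam - x \<in> cone edge_directions}" "y \<in> {x. lam - x \<in> cone edge_directions}"
      "0 \<le> u" "0 \<le> v" "u + v = (1::rat)"
    have "lam - (u *\<^sub>Q x + v *\<^sub>Q y) = (u + v) *\<^sub>Q lam - (u *\<^sub>Q x + v *\<^sub>Q y)" using * by simp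
    also have "\<dots> = u *\<^sub>Q (lam - x) + v *\<^sub>Q (lam - y)"
      unfolding scale_left_distrib by (simp add: scale_right_diff_distrib)
    finally show "lam - (u *\<^sub>Q x + v *\<^sub>Q y) \<in> cone edge_directions"
      using * by (simp add: cone_add cone_scale)
  qed
  moreover have "{w lam | w. w \<in> W} \<subseteq> {x. lam - x \<in> cone edge_directions}"
    using orbit_below unfolding W_words by auto
  ultimately have "orbit_polytope lam \<subseteq> {x. lam - x \<in> cone edge_directions}"
    unfolding orbit_polytope_def by (intro hull_minimal)
  then show "lam - x \<in> cone edge_directions" using x by blast
next
  fix e assume "e \<in> edge_directions"
  then obtain c w where "c > 0" "w \<in> W" "lam - c *\<^sub>Q e = w lam" using edge_direction_feasible by blast
  then show "\<exists>c>0. lam - c *\<^sub>Q e \<in> orbit_polytope lam"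
    unfolding orbit_polytope_def by (intro exI[of _ c]) (auto intro!: hull_inc)
qed (use edge_direction_extreme edge_directions_distinct_rays in blast)+

end

section \<open>Connected components of the Coxeter graph\<close>

lemma coxeter_edges_sym: "sym ((coxeter_edges J)\<^sup>*)"
  by (rule sym_rtrancl) (auto simp: sym_def coxeter_edges_def)

lemma component_eq:
  assumes "C \<in> components J" "s \<in> C"
  shows "C = (coxeter_edges J)\<^sup>* `` {s}"
proof -
  obtain x where x: "C = (coxeter_edges J)\<^sup>* `` {x}" using assms(1) unfolding components_def quotient_def by blast
  then have "(x, s) \<in> (coxeter_edges J)\<^sup>*" using assms(2) by blast
  moreover from this have "(s, x) \<in> (coxeter_edges J)\<^sup>*" using coxeter_edges_sym by (rule symD[rotated])
  ultimately show ?thesis unfolding x by (auto intro: rtrancl_trans)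
qed

lemma component_subset: "C \<in> components J \<Longrightarrow> C \<subseteq> J"
proof
  fix t assume C: "C \<in> components J" "t \<in> C"
  then obtain x where x: "x \<in> J" "(x, t) \<in> (coxeter_edges J)\<^sup>*"
    unfolding components_def quotient_def by blast
  show "t \<in> J" using x(2,1) by (induction) (auto simp: coxeter_edges_def)
qed

lemma component_nonempty: "C \<in> components J \<Longrightarrow> \<exists>s. s \<in> C"
  unfolding components_def quotient_def by blast

lemma component_exists: "s \<in> J \<Longrightarrow> \<exists>C\<in>components J. s \<in> C"
  unfolding components_def quotient_def by blast

lemma component_closed:
  assumes "C \<in> components J" "s \<in> C" "t \<in> J" "s \<circ> t \<noteq> t \<circ> s"
  shows "t \<in> C"
proof -
  have "(s, t) \<in> coxeter_edges J" using assms component_subset by (auto simp: coxeter_edges_def)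
  then show ?thesis using component_eq[OF assms(1,2)] by blast
qed

lemma component_subsetI:
  assumes "C \<in> components J" "s \<in> C" "s \<in> D"
    and closed: "\<And>s t. s \<in> D \<Longrightarrow> s \<in> J \<Longrightarrow> t \<in> J \<Longrightarrow> s \<circ> t \<noteq> t \<circ> s \<Longrightarrow> t \<in> D"
  shows "C \<subseteq> D"
proof
  fix t assume "t \<in> C"
  then have "(s, t) \<in> (coxeter_edges J)\<^sup>*" using component_eq[OF assms(1,2)] by blast
  then show "t \<in> D"
    by induction (use assms(3) closed in \<open>auto simp: coxeter_edges_def\<close>)
qed

section \<open>Simplicity from the number of edges at one vertex\<close>

context weyl_group
begin

interpretation pair: finite_dimensional_vector_space_pair_1 scale \<Delta> scale
  by unfold_locales

lemma linear_image_edges_at: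
  assumes add: "\<And>x y. f (x + y) = f x + f y" and scale: "\<And>c x. f (c *\<^sub>Q x) = c *\<^sub>Q f x"
    and g: "\<And>x. g (f x) = x" and P: "f ` P = P" and e: "e \<in> edges_at P x"
  shows "f ` e \<in> edges_at P (f x)"
proof -
  have diff: "f (x - y) = f x - f y" for x y using add[of "x - y" y] by simp
  have inj: "inj f" using g by (rule inj_on_inverseI)
  have seg: "f z \<in> open_segment (f a) (f b) \<longleftrightarrow> z \<in> open_segment a b" for z a b
    unfolding open_segment_def by (auto simp: inj_eq[OF inj] simp flip: add scale)
  have "face_of e P" "aff_dim e = 1" "x \<in> e"
    using e by (auto simp: edges_at_def edge_of_def)
  have "face_of (f ` e) P"
    unfolding face_of_def
  proof (intro conjI ballI impI)
    show "f ` e \<subseteq> P" using \<open>face_of e P\<close> P unfolding face_of_def by blast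
    show "convex (f ` e)"
      unfolding convex_def
    proof (intro ballI allI impI)
      fix y z u v assume "y \<in> f ` e" "z \<in> f ` e" and uv: "0 \<le> u" "0 \<le> v" "u + v = (1::rat)"
      then obtain y' z' where "y = f y'" "z = f z'" "y' \<in> e" "z' \<in> e" by blast
      moreover from this have "u *\<^sub>Q y' + v *\<^sub>Q z' \<in> e"
        using \<open>face_of e P\<close> uv unfolding face_of_def convex_def by blast
      moreover have "f (u *\<^sub>Q y' + v *\<^sub>Q z') = u *\<^sub>Q f y' + v *\<^sub>Q f z'" by (simp add: add scale)
      ultimately show "u *\<^sub>Q y + v *\<^sub>Q z \<in> f ` e" by (metis imageI)
    qed
  next
    fix a b y assume ab: "a \<in> P" "b \<in> P" and y: "y \<in> f ` e" "y \<in> open_segment a b"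
    obtain a' b' y' where *: "a = f a'" "b = f b'" "y = f y'" "a' \<in> P" "b' \<in> P" "y' \<in> e"
      using ab y(1) P by blast
    then have "y' \<in> open_segment a' b'" using y(2) seg by simp
    then have "a' \<in> e" "b' \<in> e" using * \<open>face_of e P\<close> unfolding face_of_def by blast+
    then show "a \<in> f ` e" "b \<in> f ` e" using * by auto
  qed
  moreover have "aff_dim (f ` e) = 1"
  proof -
    have "{y - z | y z. y \<in> f ` e \<and> z \<in> f ` e} = f ` {y - z | y z. y \<in> e \<and> z \<in> e}"
    proof (intro equalityI subsetI)
      fix u assume "u \<in> {y - z | y z. y \<in> f ` e \<and> z \<in> f ` e}"
      then obtain y z where "y \<in> e" "z \<in> e" "u = f y - f z" by blast
      then show "u \<in> f ` {y - z | y z. y \<in> e \<and> z \<in> e}" by (auto simp flip: diff)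
    next
      fix u assume "u \<in> f ` {y - z | y z. y \<in> e \<and> z \<in> e}"
      then obtain y z where "y \<in> e" "z \<in> e" "u = f (y - z)" by blast
      then show "u \<in> {y - z | y z. y \<in> f ` e \<and> z \<in> f ` e}" using diff by blast
    qed
    moreover have "dim (f ` {y - z | y z. y \<in> e \<and> z \<in> e}) = dim {y - z | y z. y \<in> e \<and> z \<in> e}"
    proof (rule pair.dim_image_eq)
      show "Vector_Spaces.linear scale scale f"
        by unfold_locales (rule add, rule scale)
    qed (use inj inj_on_subset in blast)
    ultimately show ?thesis using \<open>aff_dim e = 1\<close> unfolding aff_dim_def by (simp split: if_splits)
  qed
  ultimately show ?thesis using \<open>x \<in> e\<close> by (auto simp: edges_at_def edge_of_def)
qed

lemma orbit_polytope_foldr: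
  assumes "set as \<subseteq> \<Delta>"
  shows "foldr reflection as ` orbit_polytope x = orbit_polytope x"
proof
  have sub: "foldr reflection bs ` orbit_polytope x \<subseteq> orbit_polytope x" if "set bs \<subseteq> \<Delta>" for bs
    unfolding orbit_polytope_def
  proof (rule hull_image_subset[OF foldr_reflection_add foldr_reflection_scale])
    show "foldr reflection bs ` {w x | w. w \<in> W} \<subseteq> {w x | w. w \<in> W}"
    proof clarify
      fix w assume "w \<in> W"
      then obtain cs where cs: "set cs \<subseteq> \<Delta>" "w = foldr reflection cs" unfolding W_words by blast
      then have "foldr reflection (bs @ cs) \<in> W" using that unfolding W_words by (auto intro!: exI[of _ "bs @ cs"])
      moreover have "foldr reflection bs (w x) = foldr reflection (bs @ cs) x" using cs by simp
      ultimately show "\<exists>w'. foldr reflection bs (w x) = w' x \<and> w' \<in> W" by blast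
    qed
  qed
  show "foldr reflection as ` orbit_polytope x \<subseteq> orbit_polytope x" using sub assms .
  show "orbit_polytope x \<subseteq> foldr reflection as ` orbit_polytope x"
  proof
    fix y assume "y \<in> orbit_polytope x"
    then have "foldr reflection (rev as) y \<in> orbit_polytope x" using sub[of "rev as"] assms by auto
    moreover have "y = foldr reflection as (foldr reflection (rev as) y)"
      using foldr_reflection_rev[of "rev as" y] by simp
    ultimately show "y \<in> foldr reflection as ` orbit_polytope x" by blast
  qed
qed

lemma card_edges_at_orbit:
  assumes "w \<in> W"
  shows "card (edges_at (orbit_polytope x) (w y)) = card (edges_at (orbit_polytope x) y)"
proof -
  let ?P = "orbit_polytope x"
  obtain as where as: "set as \<subseteq> \<Delta>" "w = foldr reflection as" using assms unfolding W_words by blast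
  define v where "v = foldr reflection (rev as)"
  have vw: "v (w z) = z" "w (v z) = z" for z
    using foldr_reflection_rev[of as z] foldr_reflection_rev[of "rev as" z] by (simp_all add: v_def as)
  have "w ` ?P = ?P" "v ` ?P = ?P"
    using orbit_polytope_foldr[of as x] orbit_polytope_foldr[of "rev as" x] as by (simp_all add: v_def)
  then have w: "w ` e \<in> edges_at ?P (w z)" if "e \<in> edges_at ?P z" for e z
    using linear_image_edges_at[of w v ?P e z] that vw
    by (simp add: as foldr_reflection_add foldr_reflection_scale)
  from \<open>v ` ?P = ?P\<close> have v: "v ` e \<in> edges_at ?P (v z)" if "e \<in> edges_at ?P z" for e z
    using linear_image_edges_at[of v w ?P e z] that vw
    by (simp add: v_def foldr_reflection_add foldr_reflection_scale)
  have "bij_betw ((`) w) (edges_at ?P y) (edges_at ?P (w y))"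
  proof (rule bij_betw_byWitness[where f' = "(`) v"])
    show "(`) v ` edges_at ?P (w y) \<subseteq> edges_at ?P y" using v[of _ "w y"] vw by auto
  qed (use w vw in \<open>auto simp: image_image\<close>)
  then show ?thesis using bij_betw_same_card by metis
qed

end

locale nondegenerate_vector = dominant_vector scale form \<Phi> \<Delta> lam
  for scale :: "rat \<Rightarrow> 'v::ab_group_add \<Rightarrow> 'v" (infixr "*\<^sub>Q" 75)
    and form :: "'v \<Rightarrow> 'v \<Rightarrow> rat" and \<Phi> \<Delta> :: "'v set" and lam :: 'v +
  assumes nondegenerate: "D \<in> components simple_reflections \<Longrightarrow> \<not> D \<subseteq> reflection ` fixing_roots"
begin

text \<open>Starting from a moving root in its component, every simple root is reached along edges of
  the Coxeter graph, and each edge produces the next root as a difference of two vectors of the span.\<close>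

lemma span_edge_directions: "span edge_directions = UNIV"
proof -
  let ?U = "span edge_directions"
  have invariant: "reflection g x \<in> ?U" if g: "g \<in> fixing_roots" and "x \<in> ?U" for g x
    using that(2)
  proof (induction rule: span_induct_alt)
    case base
    show ?case by (simp add: span_zero)
  next
    case (step c x y)
    then show ?case
      using stabilizer_orbit.step[OF _ g]
      by (simp add: reflection_add reflection_scale span_add span_scale span_base)
  qed
  have "a \<in> ?U" if a: "a \<in> \<Delta>" for a
  proof -
    let ?r = "(coxeter_edges simple_reflections)\<^sup>*"
    obtain D where D: "D \<in> components simple_reflections" "reflection a \<in> D"
      using component_exists a by (metis imageI simple_reflections_def)
    then obtain s where s: "s \<in> D" "s \<notin> reflection ` fixing_roots" using nondegenerate by blast
    then obtain b where b: "b \<in> \<Delta>" "s = reflection b" "b \<notin> fixing_roots"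
      using component_subset[OF D(1)] unfolding simple_reflections_def by blast
    have moving: "d \<in> ?U" if "d \<in> \<Delta>" "d \<notin> fixing_roots" for d
      using that by (intro span_base stabilizer_orbit.start) simp
    have "D \<subseteq> reflection ` (\<Delta> \<inter> ?U)"
    proof (rule component_subsetI[OF D(1) s(1)])
      show "s \<in> reflection ` (\<Delta> \<inter> ?U)" using b moving by blast
    next
      fix s t assume st: "s \<in> reflection ` (\<Delta> \<inter> ?U)" "t \<in> simple_reflections" "s \<circ> t \<noteq> t \<circ> s"
      then obtain c d where cd: "c \<in> \<Delta>" "c \<in> ?U" "s = reflection c" "d \<in> \<Delta>" "t = reflection d"
        unfolding simple_reflections_def by blast
      have "c \<noteq> d" using st(3) cd by auto
      then have "form c d \<noteq> 0" using reflections_commute_iff st(3) cd by blast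
      have "d \<in> ?U"
      proof (cases "d \<in> fixing_roots")
        case True
        have "c - reflection d c \<in> ?U" using invariant[OF True] cd(2) by (simp add: span_diff)
        moreover have "c - reflection d c = (2 * form c d / form d d) *\<^sub>Q d" by (simp add: reflection_def)
        moreover have "2 * form c d / form d d \<noteq> 0"
          using \<open>form c d \<noteq> 0\<close> form_self_pos[OF cd(4)] by simp
        ultimately have "d \<in> ?U" by (metis subspace_span span_scale scale_scale scale_one left_inverse)
        then show ?thesis .
      qed (use moving cd in blast)
      then show "t \<in> reflection ` (\<Delta> \<inter> ?U)" using cd by blast
    qed
    then obtain a' where "a' \<in> \<Delta>" "a' \<in> ?U" "reflection a = reflection a'" using D(2) by blast
    then show ?thesis using inj_onD[OF inj_reflection] a by blast
  qed
  then have "span \<Delta> \<subseteq> ?U" by (intro span_minimal) auto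
  then show ?thesis using base_span by blast
qed

text \<open>A spanning set has as many elements as a basis exactly when it is independent.\<close>

lemma card_edge_directions_iff: "card edge_directions = card \<Delta> \<longleftrightarrow> independent edge_directions"
proof
  assume "card edge_directions = card \<Delta>"
  then show "independent edge_directions"
    using base.card_le_dim_spanning[of edge_directions UNIV] finite_edge_directions span_edge_directions
    by (simp add: base.dim_UNIV)
next
  assume "independent edge_directions"
  then have "card edge_directions = dim (UNIV :: 'v set)"
    using span_edge_directions by (intro basis_card_eq_dim) auto
  then show "card edge_directions = card \<Delta>" by (simp add: base.dim_UNIV)
qed

lemma card_edge_directions_ge: "card \<Delta> \<le> card edge_directions"
  using dim_le_card[of UNIV edge_directions] finite_edge_directions span_edge_directions
  by (simp add: base.dim_UNIV)

lemma aff_dim_orbit_polytope: "aff_dim (orbit_polytope lam) = int (card \<Delta>)"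
proof -
  let ?D = "{x - y | x y. x \<in> orbit_polytope lam \<and> y \<in> orbit_polytope lam}"
  have "e \<in> span ?D" if "e \<in> edge_directions" for e
  proof -
    obtain c where c: "0 < c" "lam - c *\<^sub>Q e \<in> orbit_polytope lam" using ray_feasible \<open>e \<in> _\<close> by blast
    then have "c *\<^sub>Q e \<in> ?D" using p_in_P by force
    then have "(1 / c) *\<^sub>Q (c *\<^sub>Q e) \<in> span ?D" by (intro span_scale span_base)
    then show ?thesis using c by simp
  qed
  then have "span edge_directions \<subseteq> span ?D" by (intro span_minimal) auto
  then have "span ?D = span UNIV" using span_edge_directions by auto
  then have "dim ?D = dim (UNIV :: 'v set)" by (rule span_eq_dim)
  then show ?thesis unfolding aff_dim_def using p_in_P by (auto simp: base.dim_UNIV)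
qed

text \<open>All vertices of the polytope lie in the orbit of \<open>lam\<close>, and \<open>W\<close> permutes its edges.\<close>

lemma simple_iff_card_edges:
  "simple_polytope (orbit_polytope lam) \<longleftrightarrow> card (edges_at (orbit_polytope lam) lam) = card \<Delta>"
proof
  assume "simple_polytope (orbit_polytope lam)"
  then show "card (edges_at (orbit_polytope lam) lam) = card \<Delta>"
    using vertex aff_dim_orbit_polytope unfolding simple_polytope_def by simp
next
  assume card: "card (edges_at (orbit_polytope lam) lam) = card \<Delta>"
  show "simple_polytope (orbit_polytope lam)"
    unfolding simple_polytope_def
  proof (intro conjI allI impI)
    show "polytope (orbit_polytope lam)"
      unfolding polytope_def orbit_polytope_def using finite_orbit by blast
    fix x assume "vertex_of x (orbit_polytope lam)"
    then have "x \<in> {w lam | w. w \<in> W}" unfolding orbit_polytope_def by (rule vertex_of_hull)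
    then show "int (card (edges_at (orbit_polytope lam) x)) = aff_dim (orbit_polytope lam)"
      using card_edges_at_orbit card aff_dim_orbit_polytope by auto
  qed
qed

end

section \<open>Coxeter relations between simple reflections\<close>

lemma (in group) ord_eq_prime_iff:
  assumes "x \<in> carrier G" "prime (p::nat)"
  shows "ord x = p \<longleftrightarrow> x \<noteq> \<one> \<and> x [^] p = \<one>"
  using assms pow_eq_id[OF assms(1), of p] ord_eq_1[OF assms(1)]
  by (metis dvd_refl not_prime_1 prime_nat_iff)

context weyl_group
begin

lemma noncommuting_iff:
  assumes "a \<in> \<Delta>" "b \<in> \<Delta>"
  shows "reflection a \<circ> reflection b \<noteq> reflection b \<circ> reflection a \<longleftrightarrow> a \<noteq> b \<and> form a b \<noteq> 0"
  using reflections_commute_iff[OF assms] by auto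

lemma
  assumes "a \<in> \<Delta>" "b \<in> \<Delta>" "a \<noteq> b"
  shows ord_2_iff: "group.ord (BijGroup UNIV) (reflection a \<circ> reflection b) = 2 \<longleftrightarrow>
      (\<forall>x. reflection a (reflection b x) = reflection b (reflection a x))"
    and ord_3_iff: "group.ord (BijGroup UNIV) (reflection a \<circ> reflection b) = 3 \<longleftrightarrow>
      (\<forall>x. reflection a (reflection b (reflection a x)) = reflection b (reflection a (reflection b x)))"
proof -
  let ?G = "BijGroup (UNIV :: 'v set)" and ?x = "reflection a \<circ> reflection b"
  interpret G: group ?G by (rule group_BijGroup)
  have carrier: "carrier ?G = Bij UNIV" by (simp add: BijGroup_def)
  have refl: "reflection c \<in> carrier ?G" for c
    using simple_reflections_Bij by (simp add: carrier)
  have mult: "f \<otimes>\<^bsub>?G\<^esub> g = f \<circ> g" if "f \<in> carrier ?G" "g \<in> carrier ?G" for f g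
    using that BijGroup_UNIV_mult by (simp add: carrier)
  have x: "?x \<in> carrier ?G" using G.m_closed[OF refl refl, of a b] by (simp add: mult refl)
  have "?x \<noteq> \<one>\<^bsub>?G\<^esub>"
  proof
    assume "?x = \<one>\<^bsub>?G\<^esub>"
    then have "reflection a (reflection b x) = x" for x
      by (metis BijGroup_UNIV_one comp_apply id_apply)
    then have "reflection b = reflection a" by (metis ext reflection_reflection)
    then show False using inj_onD[OF inj_reflection] assms by blast
  qed
  have "?x [^]\<^bsub>?G\<^esub> (2::nat) = ?x \<circ> ?x"
    by (simp add: numeral_2_eq_2 G.nat_pow_Suc x mult)
  moreover have "?x [^]\<^bsub>?G\<^esub> (3::nat) = ?x \<circ> ?x \<circ> ?x"
    using G.m_closed[OF x x] by (simp add: numeral_3_eq_3 G.nat_pow_Suc x mult)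
  ultimately have
    2: "G.ord ?x = 2 \<longleftrightarrow> (\<forall>x. reflection a (reflection b (reflection a (reflection b x))) = x)" and
    3: "G.ord ?x = 3 \<longleftrightarrow> (\<forall>x. reflection a (reflection b (reflection a (reflection b
          (reflection a (reflection b x))))) = x)"
    using G.ord_eq_prime_iff[OF x, of 2] G.ord_eq_prime_iff[OF x, of 3] \<open>?x \<noteq> _\<close>
    by (auto simp: BijGroup_UNIV_one fun_eq_iff two_is_prime_nat prime_nat_numeral_eq)
  show "G.ord ?x = 2 \<longleftrightarrow> (\<forall>x. reflection a (reflection b x) = reflection b (reflection a x))"
    unfolding 2 by (metis reflection_reflection)
  show "G.ord ?x = 3 \<longleftrightarrow>
      (\<forall>x. reflection a (reflection b (reflection a x)) = reflection b (reflection a (reflection b x)))"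
    unfolding 3 by (metis reflection_reflection)
qed

end

section \<open>The orbit of a vector at the end of a type A chain\<close>

definition type_A_relations :: "('a \<Rightarrow> 'a) list \<Rightarrow> bool" where
  "type_A_relations xs \<longleftrightarrow> (\<forall>i j. i < j \<longrightarrow> j < length xs \<longrightarrow>
     (if j = Suc i then \<forall>x. (xs ! i) ((xs ! j) ((xs ! i) x)) = (xs ! j) ((xs ! i) ((xs ! j) x))
      else \<forall>x. (xs ! i) ((xs ! j) x) = (xs ! j) ((xs ! i) x)))"

lemma type_A_relations_braid:
  assumes "type_A_relations xs" "Suc i < length xs"
  shows "(xs ! i) ((xs ! Suc i) ((xs ! i) x)) = (xs ! Suc i) ((xs ! i) ((xs ! Suc i) x))"
  using assms(1)[unfolded type_A_relations_def, rule_format, of i "Suc i"] assms(2) by simp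

lemma type_A_relations_commute:
  assumes "type_A_relations xs" "Suc i < j" "j < length xs"
  shows "(xs ! i) ((xs ! j) x) = (xs ! j) ((xs ! i) x)"
  using assms(1)[unfolded type_A_relations_def, rule_format, of i j] assms(2,3) by simp

lemma type_A_relations_rev:
  assumes "type_A_relations xs"
  shows "type_A_relations (rev xs)"
  unfolding type_A_relations_def
proof (intro allI impI)
  fix i j assume ij: "i < j" "j < length (rev xs)"
  define i' j' where "i' = length xs - Suc j" and "j' = length xs - Suc i"
  have eq: "rev xs ! i = xs ! j'" "rev xs ! j = xs ! i'" using ij by (simp_all add: rev_nth i'_def j'_def)
  have "i' < j'" "j' < length xs" "j = Suc i \<longleftrightarrow> j' = Suc i'"
    using ij by (auto simp: i'_def j'_def)
  then show "if j = Suc i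
      then \<forall>x. (rev xs ! i) ((rev xs ! j) ((rev xs ! i) x)) = (rev xs ! j) ((rev xs ! i) ((rev xs ! j) x))
      else \<forall>x. (rev xs ! i) ((rev xs ! j) x) = (rev xs ! j) ((rev xs ! i) x)"
    using assms unfolding eq type_A_relations_def by (metis (no_types, lifting))
qed

text \<open>In a chain of involutions with the relations of type \<open>A\<close> whose members after the first fix
  \<open>p 0\<close>, the successive images of \<open>p 0\<close> exhaust its orbit.\<close>

lemma chain_orbit:
  fixes p :: "nat \<Rightarrow> 'a" and r :: "nat \<Rightarrow> 'a \<Rightarrow> 'a"
  assumes p: "\<And>i. i < n \<Longrightarrow> p (Suc i) = r i (p i)"
    and inv: "\<And>i x. i < n \<Longrightarrow> r i (r i x) = x"
    and commute: "\<And>i j x. Suc i < j \<Longrightarrow> j < n \<Longrightarrow> r i (r j x) = r j (r i x)"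
    and braid: "\<And>i x. Suc i < n \<Longrightarrow> r i (r (Suc i) (r i x)) = r (Suc i) (r i (r (Suc i) x))"
    and fixed: "\<And>i. 0 < i \<Longrightarrow> i < n \<Longrightarrow> r i (p 0) = p 0"
    and ij: "j < n" "i \<le> n"
  shows "r j (p i) \<in> p ` {..n}"
proof -
  have later: "r j (p i) = p i" if "i < j" "j < n" for i j
    using that
  proof (induction i)
    case 0
    then show ?case using fixed by simp
  next
    case (Suc i)
    then show ?case using p[of i] commute[of i j "p i"] by simp
  qed
  \<comment> \<open>\<open>r j\<close> commutes past the later involutions, and the braid relation then turns it into
    \<open>r (Suc j)\<close>, which fixes \<open>p j\<close>.\<close>
  have earlier: "r j (p (Suc (Suc (j + k)))) = p (Suc (Suc (j + k)))" if "Suc (j + k) < n" for k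
    using that
  proof (induction k)
    case 0
    then have "p (Suc (Suc j)) = r (Suc j) (r j (p j))" using p[of j] p[of "Suc j"] by simp
    moreover have "r (Suc j) (p j) = p j" using later 0 by simp
    ultimately show ?case using braid[of j "p j"] 0 by simp
  next
    case (Suc k)
    then show ?case using p[of "Suc (Suc (j + k))"] commute[of j "Suc (Suc (j + k))"] by simp
  qed
  consider "i < j" | "i = j" | "i = Suc j" | "Suc (Suc j) \<le> i"
    by linarith
  then show ?thesis
  proof cases
    case 1
    then show ?thesis using later ij by simp
  next
    case 2
    then have "r j (p i) = p (Suc j)" using p[of j] ij by simp
    then show ?thesis using ij by (intro image_eqI[of _ _ "Suc j"]) auto
  next
    case 3
    then have "r j (p i) = p j" using p[of j] inv[of j "p j"] ij by simp
    then show ?thesis using ij by (intro image_eqI[of _ _ j]) auto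
  next
    case 4
    then obtain k where "i = Suc (Suc (j + k))" using le_Suc_ex[of "Suc (Suc j)" i] by auto
    then show ?thesis using earlier ij by simp
  qed
qed

context dominant_vector
begin

lemma moves_iff: "g \<in> fixing_roots \<Longrightarrow> reflection g x = x \<longleftrightarrow> form x g = 0"
  using reflection_fixed_iff base_nonzero fixing_rootsD by blast

lemma moving_fixing_commute_iff:
  assumes "a \<in> moving_roots" "g \<in> fixing_roots"
  shows "reflection a \<circ> reflection g \<noteq> reflection g \<circ> reflection a \<longleftrightarrow> reflection g a \<noteq> a"
  using assms noncommuting_iff[of a g] fixing_rootsD moves_iff by auto

lemma stabilizer_orbit_trivial:
  assumes "\<And>g. g \<in> fixing_roots \<Longrightarrow> reflection g a = a"
  shows "stabilizer_orbit {a} = {a}"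
proof (intro equalityI subsetI)
  fix x assume "x \<in> stabilizer_orbit {a}"
  then show "x \<in> {a}" by induction (use assms in auto)
qed (auto intro: stabilizer_orbit.start)

lemma card_stabilizer_orbit_type_A:
  assumes a: "a \<in> moving_roots" and t: "t \<in> reflection ` fixing_roots" "t a \<noteq> a"
    and unique: "\<And>u. u \<in> reflection ` fixing_roots \<Longrightarrow> u a \<noteq> a \<Longrightarrow> u = t"
    and C: "C \<in> components (reflection ` fixing_roots)" "t \<in> C" "type_A_setup C t"
  shows "card (stabilizer_orbit {a}) \<le> Suc (card C)"
proof -
  have CJ: "C \<subseteq> reflection ` fixing_roots" by (rule component_subset) fact
  obtain ys where ys: "set ys = C" "type_A_numbering ys" "t = hd ys \<or> t = last ys" "ys \<noteq> []"
    using C(3) unfolding type_A_setup_def by blast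
  have "type_A_relations ys"
    unfolding type_A_relations_def
  proof (intro allI impI)
    fix i j assume ij: "i < j" "j < length ys"
    then have "ys ! i \<in> C" "ys ! j \<in> C" using ys(1) by auto
    then obtain g h where gh: "g \<in> fixing_roots" "h \<in> fixing_roots" "ys ! i = reflection g" "ys ! j = reflection h"
      using CJ by blast
    have "ys ! i \<noteq> ys ! j" using ys(2) ij unfolding type_A_numbering_def by (simp add: nth_eq_iff_index_eq)
    then have "g \<noteq> h" using gh by auto
    moreover have "group.ord (BijGroup UNIV) (ys ! i \<circ> ys ! j) = (if j = Suc i then 3 else 2)"
      using ys(2) ij unfolding type_A_numbering_def by blast
    ultimately show "if j = Suc i
        then \<forall>x. (ys ! i) ((ys ! j) ((ys ! i) x)) = (ys ! j) ((ys ! i) ((ys ! j) x))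
        else \<forall>x. (ys ! i) ((ys ! j) x) = (ys ! j) ((ys ! i) x)"
      using ord_2_iff[of g h] ord_3_iff[of g h] gh fixing_rootsD by (auto split: if_splits)
  qed
  \<comment> \<open>The relations are symmetric, so the chain may be read from the end that is \<open>t\<close>.\<close>
  then have "\<exists>xs. set xs = C \<and> distinct xs \<and> xs \<noteq> [] \<and> hd xs = t \<and> type_A_relations xs"
  proof (cases "t = hd ys")
    case True
    then show ?thesis using ys \<open>type_A_relations ys\<close> unfolding type_A_numbering_def by blast
  next
    case False
    then have "hd (rev ys) = t" using ys(3,4) by (simp add: hd_rev)
    then show ?thesis
      using ys type_A_relations_rev[OF \<open>type_A_relations ys\<close>]
      unfolding type_A_numbering_def by (intro exI[of _ "rev ys"]) simp
  qed
  then obtain xs where xs: "set xs = C" "distinct xs" "xs \<noteq> []" "hd xs = t"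
    and rel: "type_A_relations xs"
    by blast
  define p where "p i = fold (\<lambda>s. s) (take i xs) a" for i
  have p0: "p 0 = a" by (simp add: p_def)
  have pSuc: "p (Suc i) = (xs ! i) (p i)" if "i < length xs" for i
    using that by (simp add: p_def take_Suc_conv_app_nth)
  have mem: "xs ! i \<in> reflection ` fixing_roots" if "i < length xs" for i
    using that CJ xs(1) nth_mem by blast
  have fixed: "(xs ! i) a = a" if "0 < i" "i < length xs" for i
  proof (rule ccontr)
    assume "(xs ! i) a \<noteq> a"
    then have "xs ! i = t" using unique mem that by blast
    then have "xs ! i = xs ! 0" using xs(3,4) by (simp add: hd_conv_nth)
    then show False using nth_eq_iff_index_eq[OF xs(2), of i 0] that xs(3) by auto
  qed
  have involution: "u (u x) = x" if "u \<in> reflection ` fixing_roots" for u x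
    using that by auto
  have "stabilizer_orbit {a} \<subseteq> p ` {..length xs}"
  proof
    fix x assume "x \<in> stabilizer_orbit {a}"
    then show "x \<in> p ` {..length xs}"
    proof induction
      case (start x)
      then show ?case using p0 by force
    next
      case (step x g)
      then obtain i where i: "i \<le> length xs" "x = p i" by blast
      show ?case
      proof (cases "reflection g \<in> C")
        case True
        then obtain j where j: "j < length xs" "xs ! j = reflection g"
          using xs(1) by (metis in_set_conv_nth)
        have "(xs ! j) (p i) \<in> p ` {..length xs}"
        proof (rule chain_orbit[where r = "\<lambda>i. xs ! i"])
          show "(xs ! i) ((xs ! j) x) = (xs ! j) ((xs ! i) x)" if "Suc i < j" "j < length xs" for i j x
            using type_A_relations_commute[OF rel that] .
          show "(xs ! i) ((xs ! Suc i) ((xs ! i) x)) = (xs ! Suc i) ((xs ! i) ((xs ! Suc i) x))"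
            if "Suc i < length xs" for i x
            using type_A_relations_braid[OF rel that] .
        qed (use pSuc involution mem fixed p0 i j in auto)
        then show ?thesis using i j by simp
      next
        case False
        have "reflection g a = a" using unique[of "reflection g"] step(2) False C(2) by blast
        moreover have "reflection g (u y) = u (reflection g y)" if "u \<in> C" for u y
          using component_closed[OF C(1) that, of "reflection g"] step(2) False by (metis comp_apply imageI)
        ultimately have "reflection g (p j) = p j" if "j \<le> length xs" for j
          using that
        proof (induction j)
          case (Suc j)
          then have "xs ! j \<in> C" using xs(1) by auto
          then show ?case using Suc pSuc[of j] by simp
        qed (simp add: p0)
        then show ?thesis using i by auto
      qed
    qed
  qed
  then have "card (stabilizer_orbit {a}) \<le> card (p ` {..length xs})" by (intro card_mono) auto
  also have "\<dots> \<le> card {..length xs}" by (rule card_image_le) simp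
  also have "\<dots> = Suc (card C)" using xs(1,2) by (simp flip: distinct_card)
  finally show ?thesis .
qed

end

section \<open>Counting orbits under the conditions on the Coxeter graph\<close>

context nondegenerate_vector
begin

abbreviation J :: "('v \<Rightarrow> 'v) set" where
  "J \<equiv> reflection ` fixing_roots"

lemma moving_reflections: "simple_reflections - J = reflection ` moving_roots"
  using inj_on_image_set_diff[OF inj_reflection, of \<Delta> fixing_roots]
  unfolding simple_reflections_def by (auto simp: fixing_roots_def)

lemma J_subset_centralizer_iff:
  "J \<subseteq> centralizer W s \<longleftrightarrow> (\<forall>t\<in>J. s \<circ> t = t \<circ> s)"
proof -
  have "J \<subseteq> W"
    using fixing_rootsD unfolding W_def simple_reflections_def by (auto intro: generate.incl)
  then show ?thesis unfolding centralizer_def by (auto simp: eq_commute)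
qed

definition type_A_attachment :: bool where
  "type_A_attachment \<longleftrightarrow> (\<forall>s \<in> simple_reflections - J. \<not> J \<subseteq> centralizer W s \<longrightarrow>
     (\<exists>!t. t \<in> J \<and> s \<circ> t \<noteq> t \<circ> s) \<and>
     (\<forall>t \<in> J. s \<circ> t \<noteq> t \<circ> s \<longrightarrow> (\<forall>C \<in> components J. t \<in> C \<longrightarrow> type_A_setup C t)))"

definition single_attachment :: bool where
  "single_attachment \<longleftrightarrow>
     (\<forall>C \<in> components J. \<exists>!s. s \<in> simple_reflections - J \<and> (\<exists>t \<in> C. s \<circ> t \<noteq> t \<circ> s))"

text \<open>The orbit of a moving root \<open>a\<close> has at most one element more than the
  set of fixing reflections in the component attached to \<open>a\<close>. These sets are disjoint for distinct
  \<open>a\<close>, so there are at most \<open>|\<Delta>|\<close> edge directions.\<close>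

lemma attachment_imp_card_le:
  assumes type_A_attachment single_attachment
  shows "card edge_directions \<le> card \<Delta>"
proof -
  define N where "N a = \<Union>{C \<in> components J. \<exists>t\<in>C. reflection a \<circ> t \<noteq> t \<circ> reflection a}" for a
  have finite_J: "finite J" "finite fixing_roots"
    using finite_base by (auto simp: fixing_roots_def)
  have N: "N a \<subseteq> J" for a
    unfolding N_def using component_subset by blast
  have finite_N: "finite (N a)" for a using N finite_J finite_subset by blast
  have orbit: "card (stabilizer_orbit {a}) \<le> Suc (card (N a))" if a: "a \<in> moving_roots" for a
  proof (cases "\<exists>g\<in>fixing_roots. reflection g a \<noteq> a")
    case False
    then have "stabilizer_orbit {a} = {a}" by (intro stabilizer_orbit_trivial) blast
    then show ?thesis by simp
  next
    case True
    then obtain g where g: "g \<in> fixing_roots" "reflection g a \<noteq> a" by blast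
    have comm: "reflection a \<circ> t \<noteq> t \<circ> reflection a \<longleftrightarrow> t a \<noteq> a" if "t \<in> J" for t
      using that moving_fixing_commute_iff[OF a] by blast
    have outside: "\<not> J \<subseteq> centralizer W (reflection a)"
      unfolding J_subset_centralizer_iff using comm g by blast
    have "reflection a \<in> simple_reflections - J" using a moving_reflections by blast
    note cond = mp[OF bspec[OF assms(1)[unfolded type_A_attachment_def] this] outside]
    have ex1: "\<exists>!t. t \<in> J \<and> reflection a \<circ> t \<noteq> t \<circ> reflection a" by (rule conjunct1[OF cond])
    have type_A: "type_A_setup C t"
      if "t \<in> J" "reflection a \<circ> t \<noteq> t \<circ> reflection a" "C \<in> components J" "t \<in> C" for t C
      using conjunct2[OF cond] that by blast
    obtain C where C: "C \<in> components J" "reflection g \<in> C" using component_exists g by blast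
    have gJ: "reflection g \<in> J" using g by blast
    have "card (stabilizer_orbit {a}) \<le> Suc (card C)"
    proof (rule card_stabilizer_orbit_type_A[OF a gJ g(2) _ C])
      show "u = reflection g" if "u \<in> J" "u a \<noteq> a" for u
        using ex1 comm that gJ g(2) by blast
      show "type_A_setup C (reflection g)" using type_A C gJ comm g(2) by blast
    qed
    also have "card C \<le> card (N a)"
    proof (rule card_mono[OF finite_N])
      show "C \<subseteq> N a" unfolding N_def using C comm[OF gJ] g(2) by blast
    qed
    finally show ?thesis by simp
  qed
  have disjoint: "N a \<inter> N b = {}" if ab: "a \<in> moving_roots" "b \<in> moving_roots" "a \<noteq> b" for a b
  proof (rule ccontr)
    assume "N a \<inter> N b \<noteq> {}"
    then obtain s C D where *: "s \<in> C" "C \<in> components J" "\<exists>t\<in>C. reflection a \<circ> t \<noteq> t \<circ> reflection a"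
        "s \<in> D" "D \<in> components J" "\<exists>t\<in>D. reflection b \<circ> t \<noteq> t \<circ> reflection b"
      unfolding N_def by blast
    then have "D = C" using component_eq by metis
    moreover have "reflection a \<in> simple_reflections - J" "reflection b \<in> simple_reflections - J"
      using ab moving_reflections by blast+
    ultimately have "reflection a = reflection b"
      using * \<open>single_attachment\<close> unfolding single_attachment_def by blast
    then show False using inj_onD[OF inj_reflection] ab by blast
  qed
  have "card edge_directions \<le> (\<Sum>a\<in>moving_roots. card (stabilizer_orbit {a}))"
    unfolding edge_directions_Union using finite_base by (intro card_UN_le) simp
  also have "\<dots> \<le> (\<Sum>a\<in>moving_roots. Suc (card (N a)))" using orbit by (rule sum_mono)
  also have "\<dots> = card moving_roots + (\<Sum>a\<in>moving_roots. card (N a))"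
    by (simp add: sum_Suc)
  also have "(\<Sum>a\<in>moving_roots. card (N a)) = card (\<Union>a\<in>moving_roots. N a)"
    using finite_base finite_N disjoint by (intro card_UN_disjoint[symmetric]) auto
  also have "\<dots> \<le> card J" using N finite_J by (intro card_mono) auto
  also have "\<dots> \<le> card fixing_roots" using finite_J by (intro card_image_le)
  also have "card moving_roots + card fixing_roots = card \<Delta>"
    using finite_base finite_J card_mono[of \<Delta> fixing_roots]
    by (subst card_Diff_subset) (auto simp: fixing_roots_def)
  finally show ?thesis by simp
qed

text \<open>The set of fixing reflections that move the orbit of \<open>a\<close> is a union of components: if \<open>g\<close>
  moves \<open>x\<close>, then a reflection that does not commute with that of \<open>g\<close> moves one of the two
  ends of the difference \<open>x - reflection g x\<close>.\<close>

lemma component_moves_orbit: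
  assumes a: "a \<in> moving_roots" and C: "C \<in> components J"
    and t: "t \<in> C" "reflection a \<circ> t \<noteq> t \<circ> reflection a"
    and g: "g \<in> fixing_roots" "reflection g \<in> C"
  shows "\<exists>x\<in>stabilizer_orbit {a}. reflection g x \<noteq> x"
proof -
  let ?D = "reflection ` {g \<in> fixing_roots. \<exists>x\<in>stabilizer_orbit {a}. form x g \<noteq> 0}"
  have "C \<subseteq> ?D"
  proof (rule component_subsetI[OF C t(1)])
    obtain h where h: "h \<in> fixing_roots" "t = reflection h" using component_subset[OF C] t(1) by blast
    then have "form a h \<noteq> 0" using t(2) moving_fixing_commute_iff[OF a h(1)] moves_iff[OF h(1)] by simp
    then show "t \<in> ?D" using h stabilizer_orbit.start[of a "{a}"] by blast
  next
    fix s u assume su: "s \<in> ?D" "u \<in> J" "s \<circ> u \<noteq> u \<circ> s"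
    then obtain c d x where cd: "c \<in> fixing_roots" "s = reflection c" "d \<in> fixing_roots" "u = reflection d"
      and x: "x \<in> stabilizer_orbit {a}" "form x c \<noteq> 0" by blast
    have "form c d \<noteq> 0" using su(3) noncommuting_iff[of c d] cd fixing_rootsD by blast
    have "reflection c x = x - (2 * form x c / form c c) *\<^sub>Q c" by (simp add: reflection_def)
    then have "form (reflection c x) d = form x d - 2 * form x c / form c c * form c d"
      by (simp add: form_linear)
    moreover have "2 * form x c / form c c * form c d \<noteq> 0"
      using x(2) \<open>form c d \<noteq> 0\<close> form_self_pos[of c] cd fixing_rootsD by simp
    ultimately have "form x d \<noteq> 0 \<or> form (reflection c x) d \<noteq> 0" by auto
    moreover have "reflection c x \<in> stabilizer_orbit {a}" using x cd by (intro stabilizer_orbit.step)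
    ultimately show "u \<in> ?D" using x(1) cd by blast
  qed
  then obtain g' x where "g' \<in> fixing_roots" "reflection g = reflection g'"
      "x \<in> stabilizer_orbit {a}" "form x g' \<noteq> 0" using g by blast
  then show ?thesis using moves_iff by metis
qed

text \<open>Otherwise the component would also be one of the whole graph, which nondegeneracy excludes.\<close>

lemma component_touches_moving:
  assumes C: "C \<in> components J"
  shows "\<exists>s \<in> simple_reflections - J. \<exists>t\<in>C. s \<circ> t \<noteq> t \<circ> s"
proof (rule ccontr)
  assume none: "\<not> ?thesis"
  obtain t where t: "t \<in> C" using component_nonempty[OF C] by blast
  have CJ: "C \<subseteq> J" by (rule component_subset) fact
  have "J \<subseteq> simple_reflections" using fixing_rootsD by (auto simp: simple_reflections_def)
  then have "t \<in> simple_reflections" using t CJ by auto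
  from component_exists[OF this] obtain D where D: "D \<in> components simple_reflections" "t \<in> D" ..
  have "D \<subseteq> C"
  proof (rule component_subsetI[OF D t])
    fix s u assume su: "s \<in> C" "u \<in> simple_reflections" "s \<circ> u \<noteq> u \<circ> s"
    then have "u \<in> J" using none by force
    then show "u \<in> C" using component_closed[OF C su(1) _ su(3)] by blast
  qed
  then show False using nondegenerate[OF D(1)] CJ by blast
qed

end

section \<open>Independence of the edge directions\<close>

locale independent_edges = nondegenerate_vector scale form \<Phi> \<Delta> lam
  for scale :: "rat \<Rightarrow> 'v::ab_group_add \<Rightarrow> 'v" (infixr "*\<^sub>Q" 75)
    and form :: "'v \<Rightarrow> 'v \<Rightarrow> rat" and \<Phi> \<Delta> :: "'v set" and lam :: 'v +
  assumes independent_directions: "independent edge_directions"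
begin

text \<open>Two disjoint moved pairs would give a linear relation, because both differences are multiples
  of the same root.\<close>

lemma moves_one_pair:
  assumes g: "g \<in> fixing_roots" and x: "x \<in> edge_directions" "reflection g x \<noteq> x"
    and y: "y \<in> edge_directions" "reflection g y \<noteq> y"
  shows "y = x \<or> y = reflection g x"
proof (rule ccontr)
  assume no: "\<not> ?thesis"
  define c d where "c = 2 * form x g / form g g" and "d = 2 * form y g / form g g"
  have c: "c \<noteq> 0" using x(2) moves_iff[OF g] form_self_pos[of g] fixing_rootsD(1)[OF g] by (simp add: c_def)
  have rx: "x - reflection g x = c *\<^sub>Q g" and ry: "y - reflection g y = d *\<^sub>Q g"
    by (simp_all add: reflection_def c_def d_def)
  let ?E = "edge_directions - {y}"
  have "x \<in> ?E" "reflection g x \<in> ?E" "reflection g y \<in> ?E"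
    using x y no stabilizer_orbit.step[OF _ g] by auto
  then have "reflection g y + (d / c) *\<^sub>Q (x - reflection g x) \<in> span ?E"
    by (intro span_add span_scale span_diff span_base)
  moreover have "reflection g y + (d / c) *\<^sub>Q (x - reflection g x) = y"
    unfolding rx using c by (simp flip: ry)
  ultimately show False using independent_directions y(1) unfolding dependent_def by auto
qed

text \<open>Moved pairs of different reflections share at most one point, so each of the two reflections
  fixes the image of \<open>x\<close> under the other one. That determines the ratios of inner products that
  decide the order of the product: the Cartan integers of \<open>g\<close> and \<open>h\<close> have product 1.\<close>

lemma moved_by_two:
  assumes g: "g \<in> fixing_roots" and h: "h \<in> fixing_roots" and "g \<noteq> h"
    and x: "x \<in> edge_directions" "reflection g x \<noteq> x" "reflection h x \<noteq> x"
  shows "form g h \<noteq> 0"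
    and "reflection g (reflection h (reflection g z)) = reflection h (reflection g (reflection h z))"
proof -
  have half: "form x h = 2 * form x g / form g g * form g h"
    if g: "g \<in> fixing_roots" and h: "h \<in> fixing_roots" and "g \<noteq> h"
      and x: "reflection g x \<noteq> x" "reflection h x \<noteq> x" for g h
  proof -
    have gx: "reflection g x \<in> edge_directions" using stabilizer_orbit.step[OF assms(4) g] .
    have "reflection g x \<noteq> reflection h x"
    proof
      assume "reflection g x = reflection h x"
      then have "coef (reflection g x) g = coef x g"
        using coef_reflection[of h g x] fixing_rootsD(1)[OF h] \<open>g \<noteq> h\<close> by simp
      then have "form x g = 0"
        using form_self_pos[OF fixing_rootsD(1)[OF g]] fixing_rootsD(1)[OF g]
        by (auto simp: reflection_def coef_simps coef_base split: if_splits)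
      then show False using x(1) moves_iff[OF g] by blast
    qed
    then have "reflection h (reflection g x) = reflection g x"
      using moves_one_pair[OF h assms(4) x(2) gx] x(1) by blast
    then have "form (reflection g x) h = 0" using moves_iff[OF h] by blast
    then show ?thesis by (simp add: reflection_def form_linear)
  qed
  have gh: "form x h = 2 * form x g / form g g * form g h" using half g h \<open>g \<noteq> h\<close> x(2,3) .
  have hg: "form x g = 2 * form x h / form h h * form g h"
    using half[OF h g] \<open>g \<noteq> h\<close> x(2,3) by (simp add: form_sym[of h g])
  have nonzero: "form x g \<noteq> 0" "form x h \<noteq> 0" using x moves_iff g h by auto
  then show "form g h \<noteq> 0" using gh by auto
  define m n where "m = 2 * form g h / form g g" and "n = 2 * form g h / form h h"
  have "form x g * m = 2 * form x g / form g g * form g h" by (simp add: m_def)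
  then have xm: "form x h = form x g * m" using gh by simp
  have "form x h * n = 2 * form x h / form h h * form g h" by (simp add: n_def)
  then have xn: "form x g = form x h * n" using hg by simp
  have "form x g * (m * n) = form x g * 1" using xm xn by (metis mult.assoc mult_1_right)
  then have mn: "m * n = 1" using nonzero(1) by simp
  have "reflection g h = h - m *\<^sub>Q g" "reflection h g = g - n *\<^sub>Q h"
    by (simp_all add: reflection_def m_def n_def form_sym[of h g])
  then have "reflection g h = (- m) *\<^sub>Q reflection h g"
    using mn by (simp add: scale_right_diff_distrib)
  moreover have "- m \<noteq> 0" using mn by auto
  ultimately have "reflection (reflection g h) = reflection (reflection h g)"
    using reflection_multiple by metis
  then show "reflection g (reflection h (reflection g z)) = reflection h (reflection g (reflection h z))"
    by (metis reflection_conjugate)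
qed

text \<open>Two roots moving the same simple root \<open>a\<close> would form a triangle with it.\<close>

lemma unique_neighbour:
  assumes a: "a \<in> moving_roots" and g: "g \<in> fixing_roots" "reflection g a \<noteq> a"
    and h: "h \<in> fixing_roots" "reflection h a \<noteq> a"
  shows "g = h"
proof (rule ccontr)
  assume "g \<noteq> h"
  then have "form g h \<noteq> 0"
    using moved_by_two(1)[OF g(1) h(1)] g(2) h(2) a stabilizer_orbit.start by blast
  moreover have "form a g \<noteq> 0" "form a h \<noteq> 0" using g h moves_iff by auto
  moreover have "a \<noteq> g" "a \<noteq> h" using a g h by auto
  ultimately show False
    using no_triangle[of a g h] \<open>g \<noteq> h\<close> a g(1) h(1) fixing_rootsD by auto
qed

text \<open>The moved pairs are the edges of a graph on the edge directions, and a maximal path in it that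
  starts at \<open>a\<close> uses each reflection of the component once. A further reflection of the component
  would move a point of the path. At its end it would prolong the path, at \<open>a\<close> it would be a second
  neighbour of \<open>a\<close>, and in between it would complete a triangle of simple roots.\<close>

lemma component_type_A:
  assumes a: "a \<in> moving_roots" and t: "g\<^sub>0 \<in> fixing_roots" "reflection g\<^sub>0 a \<noteq> a"
    and C: "C \<in> components J" "reflection g\<^sub>0 \<in> C"
  shows "type_A_setup C (reflection g\<^sub>0)"
proof -
  define pt where "pt gs i = fold reflection (take i gs) a" for gs i
  define is_path where "is_path gs \<longleftrightarrow> distinct gs \<and> set gs \<subseteq> fixing_roots \<and>
     (\<forall>i<length gs. reflection (gs ! i) (pt gs i) \<noteq> pt gs i)" for gs
  have "is_path []" by (simp add: is_path_def)
  moreover have "length gs < Suc (card fixing_roots)" if "is_path gs" for gs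
  proof -
    have "length gs = card (set gs)" using that by (simp add: is_path_def distinct_card)
    also have "\<dots> \<le> card fixing_roots"
      using that finite_base by (intro card_mono) (auto simp: is_path_def fixing_roots_def)
    finally show ?thesis by simp
  qed
  ultimately obtain gs where gs: "is_path gs" and maximal: "\<And>hs. is_path hs \<Longrightarrow> length hs \<le> length gs"
    using ex_has_greatest_nat[of is_path "[]" length "Suc (card fixing_roots)"] by blast
  define n where "n = length gs"
  define p where "p = pt gs"
  have fixing: "gs ! i \<in> fixing_roots" if "i < n" for i
    using gs that nth_mem unfolding is_path_def n_def by blast
  have p0: "p 0 = a" by (simp add: p_def pt_def)
  have pSuc: "p (Suc i) = reflection (gs ! i) (p i)" if "i < n" for i
    using that by (simp add: p_def pt_def n_def take_Suc_conv_app_nth)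
  have p_moves: "reflection (gs ! i) (p i) \<noteq> p i" if "i < n" for i
    using gs that unfolding is_path_def n_def p_def by blast
  have p_dir: "p i \<in> edge_directions" if "i \<le> n" for i
    using that
  proof (induction i)
    case 0
    then show ?case using a by (simp add: p0 stabilizer_orbit.start)
  next
    case (Suc i)
    then show ?case using pSuc[of i] fixing[of i] by (simp add: stabilizer_orbit.step)
  qed
  have distinct: "gs ! i = gs ! j \<longleftrightarrow> i = j" if "i < n" "j < n" for i j
    using gs that unfolding is_path_def n_def by (simp add: nth_eq_iff_index_eq)
  \<comment> \<open>The coordinate at the \<open>i\<close>-th root changes in the \<open>i\<close>-th step only, so the path does not return.\<close>
  have step_coef: "coef (p (Suc i)) (gs ! i) \<noteq> coef (p i) (gs ! i)" if i: "i < n" for i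
  proof -
    have "gs ! i \<in> \<Delta>" using fixing[OF i] fixing_rootsD by blast
    moreover have "form (p i) (gs ! i) \<noteq> 0" using p_moves[OF i] moves_iff[OF fixing[OF i]] by blast
    ultimately show ?thesis
      using form_self_pos[of "gs ! i"] unfolding pSuc[OF i]
      by (simp add: reflection_def coef_simps coef_base)
  qed
  have later_coef: "coef (p (Suc i + k)) (gs ! i) = coef (p (Suc i)) (gs ! i)" if "Suc i + k \<le> n" for i k
    using that
  proof (induction k)
    case (Suc k)
    then have "gs ! i \<noteq> gs ! (Suc i + k)" using distinct[of i "Suc i + k"] by simp
    then show ?case
      using Suc pSuc[of "Suc i + k"] coef_reflection[of "gs ! (Suc i + k)" "gs ! i"] fixing[of "Suc i + k"]
        fixing_rootsD by simp
  qed simp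
  have p_less: "p i \<noteq> p j" if ij: "i < j" "j \<le> n" for i j
  proof -
    obtain k where "j = Suc i + k" using ij(1) by (auto simp: less_iff_Suc_add)
    then show ?thesis using later_coef[of i k] step_coef[of i] ij by auto
  qed
  have p_inj: "p i = p j \<longleftrightarrow> i = j" if "i \<le> n" "j \<le> n" for i j
    using p_less that by (metis linorder_neqE_nat)
  have moves_only: "j = i \<or> j = Suc i" if "i < n" "j \<le> n" "reflection (gs ! i) (p j) \<noteq> p j" for i j
    using moves_one_pair[OF fixing[of i] p_dir[of i] p_moves[of i] p_dir[of j]] that p_inj
    by (metis Suc_leI less_imp_le pSuc)
  have moves_next: "reflection (gs ! i) (p (Suc i)) \<noteq> p (Suc i)" if "i < n" for i
    using p_moves[OF that] pSuc[OF that] by simp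
  have diff: "\<exists>c. c \<noteq> 0 \<and> p i = p (Suc i) + c *\<^sub>Q (gs ! i)" if i: "i < n" for i
  proof -
    have "form (p i) (gs ! i) \<noteq> 0" using p_moves[OF i] moves_iff[OF fixing[OF i]] by blast
    then have "2 * form (p i) (gs ! i) / form (gs ! i) (gs ! i) \<noteq> 0"
      using form_self_pos[of "gs ! i"] fixing[OF i] fixing_rootsD by simp
    moreover have "p i = p (Suc i) + (2 * form (p i) (gs ! i) / form (gs ! i) (gs ! i)) *\<^sub>Q (gs ! i)"
      unfolding pSuc[OF i] by (simp add: reflection_def)
    ultimately show ?thesis by blast
  qed
  have adjacent: "form (gs ! i) (gs ! Suc i) \<noteq> 0"
      "reflection (gs ! i) (reflection (gs ! Suc i) (reflection (gs ! i) z))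
       = reflection (gs ! Suc i) (reflection (gs ! i) (reflection (gs ! Suc i) z))" if i: "Suc i < n" for i z
    using moved_by_two[OF fixing[of i] fixing[of "Suc i"] _ p_dir[of "Suc i"] moves_next[of i] p_moves[of "Suc i"]]
      i distinct[of i "Suc i"] by simp_all
  have apart: "form (gs ! i) (gs ! j) = 0" if ij: "Suc i < j" "j < n" for i j
  proof -
    have "form (p j) (gs ! i) = 0" "form (p (Suc j)) (gs ! i) = 0"
      using moves_only[of i j] moves_only[of i "Suc j"] ij moves_iff[OF fixing[of i]] by auto
    moreover obtain c where "c \<noteq> 0" "p j = p (Suc j) + c *\<^sub>Q (gs ! j)" using diff[of j] ij by blast
    ultimately show ?thesis by (simp add: form_linear form_sym[of "gs ! j"])
  qed
  have numbering: "type_A_numbering (map reflection gs)"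
    unfolding type_A_numbering_def
  proof (intro conjI allI impI)
    have "inj_on reflection (set gs)"
      using gs fixing_rootsD unfolding is_path_def by (intro inj_on_subset[OF inj_reflection]) blast
    then show "distinct (map reflection gs)" using gs by (simp add: is_path_def distinct_map)
    fix i j assume "i < j \<and> j < length (map reflection gs)"
    then have ij: "i < j" "j < n" by (auto simp: n_def)
    have base: "gs ! i \<in> \<Delta>" "gs ! j \<in> \<Delta>" "gs ! i \<noteq> gs ! j"
      using fixing[of i] fixing[of j] ij fixing_rootsD distinct[of i j] by auto
    show "group.ord (BijGroup UNIV) (map reflection gs ! i \<circ> map reflection gs ! j) = (if j = Suc i then 3 else 2)"
    proof (cases "j = Suc i")
      case True
      then show ?thesis using ord_3_iff[OF base] adjacent(2)[of i] ij by (simp add: n_def)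
    next
      case False
      then have "reflection (gs ! i) \<circ> reflection (gs ! j) = reflection (gs ! j) \<circ> reflection (gs ! i)"
        using reflections_commute_iff[OF base] apart[of i j] ij by simp
      then show ?thesis using ord_2_iff[OF base] False ij by (simp add: n_def fun_eq_iff)
    qed
  qed
  have "is_path [g\<^sub>0]" using t by (simp add: is_path_def pt_def)
  then have "length [g\<^sub>0] \<le> n" unfolding n_def by (rule maximal)
  then have n0: "0 < n" by simp
  have g0: "gs ! 0 = g\<^sub>0"
    using unique_neighbour[OF a fixing[OF n0] _ t] p_moves[OF n0] by (simp add: p0)
  have closed: "h \<in> set gs" if h: "h \<in> fixing_roots" and i: "i < n" "form (gs ! i) h \<noteq> 0" for h i
  proof (rule ccontr)
    assume new: "h \<notin> set gs"
    obtain c where c: "c \<noteq> 0" "p i = p (Suc i) + c *\<^sub>Q (gs ! i)" using diff i(1) by blast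
    have "form (p i) h \<noteq> 0 \<or> form (p (Suc i)) h \<noteq> 0"
    proof (rule ccontr)
      assume "\<not> ?thesis"
      then have "form (p (Suc i) + c *\<^sub>Q (gs ! i)) h = 0" "form (p (Suc i)) h = 0" by (simp_all flip: c(2))
      then show False using c(1) i(2) by (simp add: form_linear)
    qed
    then have "\<exists>j\<le>n. form (p j) h \<noteq> 0" using i(1) by (metis Suc_leI less_imp_le)
    then obtain j where j: "j \<le> n" "form (p j) h \<noteq> 0" by blast
    then have hj: "reflection h (p j) \<noteq> p j" using moves_iff[OF h] by simp
    have h_new: "gs ! k \<noteq> h" if "k < n" for k using new that nth_mem unfolding n_def by blast
    consider "j = n" | "j = 0" "0 < n" | k where "j = Suc k" "Suc k < n"
      using j(1) n0 by (metis le_eq_less_or_eq not0_implies_Suc)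
    then show False
    proof cases
      case 1
      have "is_path (gs @ [h])"
        unfolding is_path_def
      proof (intro conjI allI impI)
        show "distinct (gs @ [h])" "set (gs @ [h]) \<subseteq> fixing_roots"
          using gs h new by (auto simp: is_path_def)
        fix k assume "k < length (gs @ [h])"
        then consider "k < n" | "k = n" unfolding n_def by fastforce
        then show "reflection ((gs @ [h]) ! k) (pt (gs @ [h]) k) \<noteq> pt (gs @ [h]) k"
        proof cases
          case 1
          then show ?thesis using p_moves[of k] by (simp add: n_def p_def pt_def nth_append)
        next
          case 2
          then show ?thesis using hj \<open>j = n\<close> by (simp add: n_def p_def pt_def)
        qed
      qed
      then show False using maximal[of "gs @ [h]"] by simp
    next
      case 2
      then have "g\<^sub>0 = h" using unique_neighbour[OF a t h] hj p0 by simp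
      then show False using h_new[of 0] g0 n0 by simp
    next
      case 3
      \<comment> \<open>Three roots moving the same interior point of the path form a triangle.\<close>
      have k: "gs ! k \<in> fixing_roots" "gs ! Suc k \<in> fixing_roots" "gs ! k \<noteq> h" "gs ! Suc k \<noteq> h"
        using fixing h_new 3 by auto
      have dir: "p (Suc k) \<in> edge_directions" and hk: "reflection h (p (Suc k)) \<noteq> p (Suc k)"
        using p_dir hj 3 by auto
      have "form (gs ! k) h \<noteq> 0"
        using moved_by_two(1)[OF k(1) h k(3) dir moves_next[of k] hk] 3 by simp
      moreover have "form (gs ! Suc k) h \<noteq> 0"
        using moved_by_two(1)[OF k(2) h k(4) dir p_moves[of "Suc k"] hk] 3 by simp
      moreover have "form (gs ! k) (gs ! Suc k) \<noteq> 0" using adjacent(1) 3 by blast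
      ultimately show False
        using no_triangle[of "gs ! k" "gs ! Suc k" h] k h fixing_rootsD distinct[of k "Suc k"] 3 by auto
    qed
  qed
  have "C \<subseteq> reflection ` set gs"
  proof (rule component_subsetI[OF C])
    show "reflection g\<^sub>0 \<in> reflection ` set gs" using g0 n0 nth_mem unfolding n_def by blast
    fix s u assume su: "s \<in> reflection ` set gs" "u \<in> J" "s \<circ> u \<noteq> u \<circ> s"
    then obtain i h where ih: "i < n" "s = reflection (gs ! i)" "h \<in> fixing_roots" "u = reflection h"
      unfolding n_def by (metis (no_types, lifting) imageE in_set_conv_nth)
    then have "form (gs ! i) h \<noteq> 0"
      using noncommuting_iff[of "gs ! i" h] su(3) fixing[of i] fixing_rootsD by blast
    then show "u \<in> reflection ` set gs" using closed ih by blast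
  qed
  moreover have in_C: "reflection (gs ! i) \<in> C" if "i < n" for i
    using that
  proof (induction i)
    case 0
    then show ?case using C(2) g0 by simp
  next
    case (Suc i)
    then have "reflection (gs ! i) \<circ> reflection (gs ! Suc i) \<noteq> reflection (gs ! Suc i) \<circ> reflection (gs ! i)"
      using noncommuting_iff[of "gs ! i" "gs ! Suc i"] fixing[of i] fixing[of "Suc i"] fixing_rootsD
        adjacent(1)[of i] distinct[of i "Suc i"] by simp
    then show ?case
      using component_closed[OF C(1), of "reflection (gs ! i)" "reflection (gs ! Suc i)"] Suc fixing[of "Suc i"] by simp
  qed
  then have "reflection ` set gs \<subseteq> C" by (auto simp: n_def in_set_conv_nth)
  ultimately have "set (map reflection gs) = C" by auto
  moreover have "map reflection gs \<noteq> []" "reflection g\<^sub>0 = hd (map reflection gs)"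
    using n0 g0 by (auto simp: n_def hd_map hd_conv_nth)
  ultimately show ?thesis using numbering unfolding type_A_setup_def by blast
qed

lemma independent_imp_type_A_attachment: type_A_attachment
  unfolding type_A_attachment_def
proof (intro ballI impI conjI)
  fix s assume s: "s \<in> simple_reflections - J" "\<not> J \<subseteq> centralizer W s"
  then obtain a where a: "a \<in> moving_roots" "s = reflection a" using moving_reflections by blast
  obtain t where t: "t \<in> J" "s \<circ> t \<noteq> t \<circ> s" using s(2) J_subset_centralizer_iff by blast
  show "\<exists>!t. t \<in> J \<and> s \<circ> t \<noteq> t \<circ> s"
  proof (rule ex1I[of _ t])
    fix u assume u: "u \<in> J \<and> s \<circ> u \<noteq> u \<circ> s"
    then have "u \<in> J" "s \<circ> u \<noteq> u \<circ> s" by simp_all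
    obtain g where g: "g \<in> fixing_roots" "t = reflection g" using t(1) by (rule imageE)
    obtain h where h: "h \<in> fixing_roots" "u = reflection h" using \<open>u \<in> J\<close> by (rule imageE)
    have "reflection g a \<noteq> a"
      using moving_fixing_commute_iff[OF a(1) g(1)] t(2) unfolding a(2) g(2) by blast
    moreover have "reflection h a \<noteq> a"
      using moving_fixing_commute_iff[OF a(1) h(1)] \<open>s \<circ> u \<noteq> u \<circ> s\<close> unfolding a(2) h(2) by blast
    ultimately show "u = t" using unique_neighbour[OF a(1) g(1) _ h(1)] g(2) h(2) by simp
  qed (use t in blast)
next
  fix s t C assume *: "s \<in> simple_reflections - J" "t \<in> J" "s \<circ> t \<noteq> t \<circ> s" "C \<in> components J" "t \<in> C"
  obtain a where a: "a \<in> moving_roots" "s = reflection a" using *(1) moving_reflections by blast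
  obtain g where g: "g \<in> fixing_roots" "t = reflection g" using *(2) by (rule imageE)
  have "reflection g a \<noteq> a"
    using moving_fixing_commute_iff[OF a(1) g(1)] *(3) unfolding a(2) g(2) by blast
  then show "type_A_setup C t"
    using component_type_A[OF a(1) g(1)] *(4,5) unfolding g(2) by blast
qed

lemma independent_imp_single_attachment: single_attachment
  unfolding single_attachment_def
proof
  fix C assume C: "C \<in> components J"
  obtain s where s: "s \<in> simple_reflections - J" "\<exists>t\<in>C. s \<circ> t \<noteq> t \<circ> s"
    using component_touches_moving[OF C] by (rule bexE)
  have moved: "\<exists>a\<in>moving_roots. u = reflection a \<and> (\<exists>x\<in>stabilizer_orbit {a}. reflection g x \<noteq> x)"
    if u: "u \<in> simple_reflections - J" "\<exists>t\<in>C. u \<circ> t \<noteq> t \<circ> u" and g: "g \<in> fixing_roots" "reflection g \<in> C"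
    for u g
  proof -
    obtain a where a: "a \<in> moving_roots" "u = reflection a" using u(1) unfolding moving_reflections by auto
    obtain t where t: "t \<in> C" "reflection a \<circ> t \<noteq> t \<circ> reflection a" using u(2) unfolding a(2) by (rule bexE)
    show ?thesis using a(2) component_moves_orbit[OF a(1) C t g] by (rule bexI[OF conjI a(1)])
  qed
  show "\<exists>!s. s \<in> simple_reflections - J \<and> (\<exists>t \<in> C. s \<circ> t \<noteq> t \<circ> s)"
  proof (rule ex1I[of _ s])
    fix u assume u: "u \<in> simple_reflections - J \<and> (\<exists>t \<in> C. u \<circ> t \<noteq> t \<circ> u)"
    obtain t where t: "t \<in> C" using component_nonempty[OF C] by (rule exE)
    then have "t \<in> J" using component_subset[OF C] by (rule subsetD[rotated])
    then obtain g where "g \<in> fixing_roots" "t = reflection g" by (rule imageE)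
    with t have g: "g \<in> fixing_roots" "reflection g \<in> C" by simp_all
    obtain a x where a: "a \<in> moving_roots" "s = reflection a" and x: "x \<in> stabilizer_orbit {a}" "reflection g x \<noteq> x"
      using moved[OF s g] by (elim bexE conjE)
    obtain b y where b: "b \<in> moving_roots" "u = reflection b" and y: "y \<in> stabilizer_orbit {b}" "reflection g y \<noteq> y"
      using moved[OF conjunct1[OF u] conjunct2[OF u] g] by (elim bexE conjE)
    have "y = x \<or> y = reflection g x"
      using moves_one_pair[OF g(1)] x y stabilizer_orbit_in_directions a(1) b(1) by blast
    then have "y \<in> stabilizer_orbit {a}" using x(1) stabilizer_orbit.step[OF x(1) g(1)] by metis
    then have "a = b" using stabilizer_orbits_disjoint[OF a(1) b(1)] y(1) by blast
    then show "u = s" using a(2) b(2) by simp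
  qed (rule conjI[OF s])
qed

end

section \<open>Simple orbit polytopes\<close>

lemma (in nondegenerate_vector) card_edges_iff_attachment:
  "card (edges_at (orbit_polytope lam) lam) = card \<Delta> \<longleftrightarrow> type_A_attachment \<and> single_attachment"
proof
  assume "card (edges_at (orbit_polytope lam) lam) = card \<Delta>"
  then interpret independent_edges scale form \<Phi> \<Delta> lam
    by unfold_locales (simp add: card_edges_at card_edge_directions_iff)
  show "type_A_attachment \<and> single_attachment"
    using independent_imp_type_A_attachment independent_imp_single_attachment by blast
next
  assume "type_A_attachment \<and> single_attachment"
  then show "card (edges_at (orbit_polytope lam) lam) = card \<Delta>"
    using attachment_imp_card_le card_edge_directions_ge by (simp add: card_edges_at)
qed

theorem theorem3p2:
  fixes scale :: "rat \<Rightarrow> 'v::ab_group_add \<Rightarrow> 'v"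
    and form :: "'v \<Rightarrow> 'v \<Rightarrow> rat"
    and \<Phi> \<Delta> :: "'v set"
    and lam :: 'v
    and S W J :: "('v \<Rightarrow> 'v) set"
    and P :: "'v set"
  assumes weyl: "weyl_group scale form \<Phi> \<Delta>"
    and S_eq: "S = weyl_group.simple_reflections scale form \<Delta>"
    and W_eq: "W = weyl_group.W scale form \<Delta>"
    and lam: "lam \<in> weyl_group.chamber form \<Delta>"
    and P_eq: "P = weyl_group.orbit_polytope scale form \<Delta> lam"
    and J_eq: "J = {s \<in> S. s lam = lam}"
    and nondegenerate: "\<forall>D \<in> components S. \<not> D \<subseteq> J"
  shows "(rational_vector_space.simple_polytope scale P \<longleftrightarrow>
            card (rational_vector_space.edges_at scale P lam) = card S) \<and>
         (card (rational_vector_space.edges_at scale P lam) = card S \<longleftrightarrow>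
            (\<forall>s \<in> S - J. \<not> J \<subseteq> centralizer W s \<longrightarrow>
               (\<exists>!t. t \<in> J \<and> s \<circ> t \<noteq> t \<circ> s) \<and>
               (\<forall>t \<in> J. s \<circ> t \<noteq> t \<circ> s \<longrightarrow>
                  (\<forall>C \<in> components J. t \<in> C \<longrightarrow> type_A_setup C t))) \<and>
            (\<forall>C \<in> components J. \<exists>!s. s \<in> S - J \<and> (\<exists>t \<in> C. s \<circ> t \<noteq> t \<circ> s)))"
proof -
  interpret weyl_group scale form \<Phi> \<Delta> by (rule weyl)
  interpret dominant_vector scale form \<Phi> \<Delta> lam by unfold_locales (rule lam)
  have J: "J = reflection ` fixing_roots"
    using reflection_fixed_iff[OF base_nonzero]
    unfolding J_eq S_eq simple_reflections_def fixing_roots_def by auto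
  interpret N: nondegenerate_vector scale form \<Phi> \<Delta> lam
    by unfold_locales (use nondegenerate in \<open>simp add: S_eq J\<close>)
  have card_S: "card S = card \<Delta>"
    unfolding S_eq simple_reflections_def by (rule card_image[OF inj_reflection])
  show ?thesis
    using N.simple_iff_card_edges N.card_edges_iff_attachment
    unfolding N.type_A_attachment_def N.single_attachment_def card_S P_eq W_eq by (simp only: J S_eq)
qed

end
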